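(* The derivability problems of $\mathbf{RJ}$ and $\mathbf{RC}$ (given $A,B$, decide whether $A\vdash B$ is provable) are decidable in time bounded by a polynomial in the length $|A|+|B|$ of the sequent, of degree three for $\mathbf{RJ}$ and degree four for $\mathbf{RC}$. More precisely, $A\vdash_{\mathbf{RC}}B$ is decidable in $O(|A|^2\cdot n\cdot|B|)$ steps with $n=|\ell(\{A,B\})|$, and $A\vdash_{\mathbf{RJ}}B$ in $O(|A|^2\cdot|B|)$ steps, on random access machines in which every symbol (variable or modality) has unit size and elementary operations on symbols cost constant time.
   Context: Strictly positive formulas: $A::= p\mid \top\mid (A\land B)\mid \alpha A$, $\alpha\le\omega$; $\ell(X)$ is the set of modalities occurring in formulas of $X$; $|A|$ is the length of $A$. $\mathbf{RJ}$: $A\vdash A$; $A\vdash\top$; cut; $A\land B\vdash A$; $A\land B\vdash B$; from $A\vdash B$, $A\vdash C$ infer $A\vdash B\land C$; from $A\vdash B$ infer $\alpha A\vdash\alpha B$; $\alpha\alpha A\vdash\alpha A$; $\alpha\beta A\vdash\beta A$, $\beta\alpha A\vdash\beta A$ for $\alpha\ge\beta$; $\alpha A\land\beta B\vdash\alpha(A\land\beta B)$ for $\alpha>\beta$. $\mathbf{RC}=\mathbf{RJ}+\{\alpha A\vdash\beta A:\alpha>\beta\}$. *)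

theory Defs
  imports Main "HOL-Library.Extended_Nat"
begin

section \<open>Strictly positive formulas; modalities alpha \<le> omega are enat (\<infinity> = omega)\<close>

datatype fm = Var nat | Top | And fm fm | Dia enat fm

fun flen :: "fm \<Rightarrow> nat" where
  "flen (Var p) = 1"
| "flen Top = 1"
| "flen (And A B) = flen A + flen B + 1"
| "flen (Dia a A) = flen A + 1"

fun mods :: "fm \<Rightarrow> enat set" where
  "mods (Var p) = {}"
| "mods Top = {}"
| "mods (And A B) = mods A \<union> mods B"
| "mods (Dia a A) = insert a (mods A)"

inductive deriv :: "bool \<Rightarrow> fm \<Rightarrow> fm \<Rightarrow> bool" for c :: bool where
  refl: "deriv c A A"
| top: "deriv c A Top"
| cut: "deriv c A B \<Longrightarrow> deriv c B C \<Longrightarrow> deriv c A C"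
| andE1: "deriv c (And A B) A"
| andE2: "deriv c (And A B) B"
| andI: "deriv c A B \<Longrightarrow> deriv c A C \<Longrightarrow> deriv c A (And B C)"
| nec: "deriv c A B \<Longrightarrow> deriv c (Dia a A) (Dia a B)"
| trans4: "deriv c (Dia a (Dia a A)) (Dia a A)"
| mon1: "a \<ge> b \<Longrightarrow> deriv c (Dia a (Dia b A)) (Dia b A)"
| mon2: "a \<ge> b \<Longrightarrow> deriv c (Dia b (Dia a A)) (Dia b A)"
| J: "a > b \<Longrightarrow> deriv c (And (Dia a A) (Dia b B)) (Dia a (And A (Dia b B)))"
| C: "c \<Longrightarrow> a > b \<Longrightarrow> deriv c (Dia a A) (Dia b A)"

abbreviation RJ :: "fm \<Rightarrow> fm \<Rightarrow> bool" where "RJ \<equiv> deriv False"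
abbreviation RC :: "fm \<Rightarrow> fm \<Rightarrow> bool" where "RC \<equiv> deriv True"

text \<open>Registers hold natural numbers (one symbol per register); every
instruction costs one step. Addition and truncated subtraction only
(no multiplication), indirect addressing via Load/Store.\<close>

datatype instr =
    Const nat nat
  | Add nat nat nat
  | Sub nat nat nat
  | Load nat nat
  | Store nat nat
  | Jz nat nat
  | Jmp nat
  | Halt

type_synonym conf = "nat \<times> (nat \<Rightarrow> nat)"

definition halted :: "instr list \<Rightarrow> conf \<Rightarrow> bool" where
  "halted P cf = (fst cf \<ge> length P \<or> P ! fst cf = Halt)"

fun exec :: "instr \<Rightarrow> conf \<Rightarrow> conf" where
  "exec (Const r k) (pc, m) = (pc + 1, m(r := k))"
| "exec (Add r s t) (pc, m) = (pc + 1, m(r := m s + m t))"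
| "exec (Sub r s t) (pc, m) = (pc + 1, m(r := m s - m t))"
| "exec (Load r s) (pc, m) = (pc + 1, m(r := m (m s)))"
| "exec (Store r s) (pc, m) = (pc + 1, m(m r := m s))"
| "exec (Jz r l) (pc, m) = (if m r = 0 then (l, m) else (pc + 1, m))"
| "exec (Jmp l) (pc, m) = (l, m)"
| "exec Halt cf = cf"

definition step :: "instr list \<Rightarrow> conf \<Rightarrow> conf" where
  "step P cf = (if halted P cf then cf else exec (P ! fst cf) cf)"

definition run :: "instr list \<Rightarrow> nat \<Rightarrow> conf \<Rightarrow> conf" where
  "run P t cf = (step P ^^ t) cf"

definition init_conf :: "nat list \<Rightarrow> conf" where
  "init_conf w = (0, \<lambda>i. if i = 0 then length w
                         else if i \<le> length w then w ! (i - 1) else 0)"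

definition ram_decides_within :: "instr list \<Rightarrow> nat list \<Rightarrow> bool \<Rightarrow> nat \<Rightarrow> bool" where
  "ram_decides_within P w b T =
     (\<exists>t \<le> T. halted P (run P t (init_conf w)) \<and>
              (snd (run P t (init_conf w)) 0 = 1 \<longleftrightarrow> b))"

fun enc_mod :: "enat \<Rightarrow> nat" where
  "enc_mod (enat n) = n + 1"
| "enc_mod \<infinity> = 0"

fun enc :: "fm \<Rightarrow> nat list" where
  "enc Top = [0]"
| "enc (And A B) = 1 # enc A @ enc B"
| "enc (Dia a A) = 2 # enc_mod a # enc A"
| "enc (Var p) = [3, p]"

definition enc_sequent :: "fm \<Rightarrow> fm \<Rightarrow> nat list" where
  "enc_sequent A B = enc A @ enc B"

end

(* The diamonds of A span a tree with labelled edges, and A |- B holds iff B is true at the root of the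
   closure of this tree under the frame conditions: soundness is by induction on derivations, and by
   completeness the tree maps homomorphically into the frame of deductively closed sets. The closure has
   an explicit description: writing rep b x for the node reached from x by climbing edges labelled > b,
   x sees z through modality b iff z lies strictly below rep b x along edges labelled >= b, one of which,
   for RJ, is labelled exactly b. Hence, given the set of nodes satisfying C, one pass of the tree towards
   the root and one away from it compute the set satisfying (b C). Evaluating the tokens of B from right
   to left with a stack of such sets takes time O(|A| |B|), within both bounds. *)
theory Submission
  imports Defs
begin

section \<open>Kripke completeness for the tree of a formula\<close>

text \<open>The shape of the closure is dictated by the axioms. J together with \<open>mon1\<close>
  forces the two ends of an edge labelled above \<open>b\<close> to see the same nodes through
  \<open>b\<close>, which is why \<open>rep\<close> climbs such edges. \<open>trans4\<close>,
  \<open>mon1\<close> and \<open>mon2\<close> let a chain of edges act as one edge carrying its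
  least label; in RJ this label must be \<open>b\<close> itself, whereas axiom C allows RC to lower
  it. The explicit description avoids saturating the tree pair by pair: a set of nodes is one row of
  at most |A| + 1 truth values. On the machine side the obstacle is that instructions name registers
  by constants while the input itself starts at cell 1. The first 30 symbols are therefore moved
  away. The algorithm is written in a small structured language in which time bounds are proved
  along with correctness, and compilation costs a constant factor.\<close>

record frame =
  cnt :: nat
  par :: "nat \<Rightarrow> nat"
  lab :: "nat \<Rightarrow> enat"
  occ :: "(nat \<times> nat) list"

text \<open>Label 0 at the root is a sentinel: no modality lies below 0, so no climb leaves the
  root. Parents precede children, so index order can replace recursion over the tree in both
  passes.\<close>

definition wf_frame :: "frame \<Rightarrow> bool" where
  "wf_frame F \<longleftrightarrow> 0 < cnt F \<and> lab F 0 = 0 \<and> (\<forall>k. 0 < k \<and> k < cnt F \<longrightarrow> par F k < k)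
     \<and> (\<forall>(x, p) \<in> set (occ F). x < cnt F)"

text \<open>The test \<open>par F x < x\<close> makes the recursion terminate on arbitrary records;
  in a well-formed frame it holds on every edge that is climbed.\<close>

function rep :: "frame \<Rightarrow> enat \<Rightarrow> nat \<Rightarrow> nat" where
  "rep F b x = (if b < lab F x \<and> par F x < x then rep F b (par F x) else x)"
  by auto
termination by (relation "measure (\<lambda>(F, b, x). x)") auto

declare rep.simps [simp del]

inductive ge_path :: "frame \<Rightarrow> enat \<Rightarrow> nat \<Rightarrow> nat \<Rightarrow> bool" for F b where
  ge_refl: "z < cnt F \<Longrightarrow> ge_path F b z z"
| ge_step: "0 < v \<Longrightarrow> v < cnt F \<Longrightarrow> b \<le> lab F v \<Longrightarrow> ge_path F b v z \<Longrightarrow> ge_path F b (par F v) z"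

text \<open>Edges above \<open>b\<close> are passed until a hit, after which any edges labelled at
  least \<open>b\<close> may follow. For RJ the hit carries exactly \<open>b\<close>, so
  \<open>b\<close> is the least label of the path; for RC already the first edge can be the
  hit.\<close>

inductive down :: "bool \<Rightarrow> frame \<Rightarrow> enat \<Rightarrow> nat \<Rightarrow> nat \<Rightarrow> bool" for c F b where
  down_hit: "0 < v \<Longrightarrow> v < cnt F \<Longrightarrow> b \<le> lab F v \<Longrightarrow> c \<or> lab F v = b \<Longrightarrow> ge_path F b v z
    \<Longrightarrow> down c F b (par F v) z"
| down_step: "0 < v \<Longrightarrow> v < cnt F \<Longrightarrow> b < lab F v \<Longrightarrow> down c F b v z \<Longrightarrow> down c F b (par F v) z"

definition acc :: "bool \<Rightarrow> frame \<Rightarrow> enat \<Rightarrow> nat \<Rightarrow> nat \<Rightarrow> bool" where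
  "acc c F b x z = down c F b (rep F b x) z"

fun sat :: "bool \<Rightarrow> frame \<Rightarrow> nat \<Rightarrow> fm \<Rightarrow> bool" where
  "sat c F x (Var p) = ((x, p) \<in> set (occ F))"
| "sat c F x Top = True"
| "sat c F x (And A B) = (sat c F x A \<and> sat c F x B)"
| "sat c F x (Dia b A) = (\<exists>z. acc c F b x z \<and> sat c F z A)"

section \<open>Frame conditions of the closure and soundness\<close>

lemma wf_par: "wf_frame F \<Longrightarrow> 0 < k \<Longrightarrow> k < cnt F \<Longrightarrow> par F k < k"
  by (simp add: wf_frame_def)

lemma wf_lab_pos: "wf_frame F \<Longrightarrow> b < lab F k \<Longrightarrow> 0 < k"
  unfolding wf_frame_def by (metis gr_zeroI not_less_zero)

lemma rep_gt: "wf_frame F \<Longrightarrow> x < cnt F \<Longrightarrow> b < lab F x \<Longrightarrow> rep F b x = rep F b (par F x)"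
  by (subst rep.simps) (auto dest: wf_par wf_lab_pos)

lemma rep_not_gt: "\<not> b < lab F x \<Longrightarrow> rep F b x = x"
  by (subst rep.simps) auto

lemma rep_le: "rep F b x \<le> x"
proof (induction F b x rule: rep.induct)
  case (1 F b x)
  then show ?case by (subst rep.simps) auto
qed

lemma lab_rep_le: "wf_frame F \<Longrightarrow> x < cnt F \<Longrightarrow> lab F (rep F b x) \<le> b"
proof (induction F b x rule: rep.induct)
  case (1 F b x)
  show ?case
  proof (cases "b < lab F x")
    case True
    then show ?thesis using 1 wf_par[of F x] wf_lab_pos[of F b x]
      by (simp add: rep_gt)
  next
    case False
    then show ?thesis by (simp add: rep_not_gt)
  qed
qed

text \<open>Edges climbed for \<open>b\<close> have labels above \<open>b\<close>, hence above
  \<open>g\<close>, so the climb for \<open>g\<close> starts with the same edges.\<close>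

lemma rep_rep:
  "wf_frame F \<Longrightarrow> x < cnt F \<Longrightarrow> g \<le> b \<Longrightarrow> rep F g (rep F b x) = rep F g x"
proof (induction F b x rule: rep.induct)
  case (1 F b x)
  show ?case
  proof (cases "b < lab F x")
    case True
    then have "par F x < x" using 1 wf_par[of F x] wf_lab_pos[of F b x] by simp
    moreover have "g < lab F x" using True 1 by simp
    ultimately show ?thesis using 1 True by (simp add: rep_gt)
  next
    case False
    then show ?thesis by (simp add: rep_not_gt)
  qed
qed

lemma ge_path_bounds: "ge_path F b u z \<Longrightarrow> z < cnt F"
  by (induction rule: ge_path.induct) auto

lemma down_ge: "down c F b u z \<Longrightarrow> ge_path F b u z"
  by (induction rule: down.induct) (auto intro: ge_step)

lemma ge_path_mono: "ge_path F b u z \<Longrightarrow> g \<le> b \<Longrightarrow> ge_path F g u z"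
  by (induction rule: ge_path.induct) (auto intro: ge_path.intros)

lemma ge_path_trans: "ge_path F b u v \<Longrightarrow> ge_path F b v z \<Longrightarrow> ge_path F b u z"
  by (induction rule: ge_path.induct) (auto intro: ge_path.intros)

lemma ge_path_par:
  "ge_path F b u z \<Longrightarrow> wf_frame F \<Longrightarrow> u \<noteq> z \<Longrightarrow> ge_path F b u (par F z) \<and> 0 < z \<and> b \<le> lab F z"
proof (induction rule: ge_path.induct)
  case (ge_step v z)
  show ?case
  proof (cases "v = z")
    case True
    then show ?thesis using ge_step wf_par[of F z]
      by (auto intro!: ge_refl)
  next
    case False
    then show ?thesis using ge_step by (auto intro: ge_path.ge_step)
  qed
qed auto

text \<open>Inverts a path at its last edge, whereas the inductive rules expose the first. The
  second alternative occurs when the last edge was the hit.\<close>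

lemma down_par:
  "down c F b u z \<Longrightarrow> wf_frame F \<Longrightarrow>
    0 < z \<and> b \<le> lab F z \<and> (down c F b u (par F z) \<or> ((c \<or> lab F z = b) \<and> ge_path F b u (par F z)))"
proof (induction rule: down.induct)
  case (down_hit v z)
  show ?case
  proof (cases "v = z")
    case True
    then show ?thesis using down_hit wf_par[of F z] by (auto intro!: ge_refl)
  next
    case False
    then show ?thesis using down_hit ge_path_par[of F b v z] by (auto intro: down.down_hit)
  qed
next
  case (down_step v z)
  then show ?case by (auto intro: down.down_step ge_step)
qed

lemma ge_path_rep:
  "ge_path F b u z \<Longrightarrow> wf_frame F \<Longrightarrow> g < b \<Longrightarrow> rep F g z = rep F g u"
proof (induction rule: ge_path.induct)
  case (ge_step v z)
  then show ?case using rep_gt[of F v g] by simp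
qed auto

lemma down_rep:
  "wf_frame F \<Longrightarrow> x < cnt F \<Longrightarrow> down c F b x z \<Longrightarrow> down c F b (rep F b x) z"
proof (induction F b x rule: rep.induct)
  case (1 F b x)
  show ?case
  proof (cases "b < lab F x")
    case True
    then show ?thesis using 1 wf_par[of F x] wf_lab_pos[of F b x]
      by (simp add: rep_gt down_step)
  next
    case False
    then show ?thesis using 1 by (simp add: rep_not_gt)
  qed
qed

lemma down_mono: "down c F b u z \<Longrightarrow> c \<Longrightarrow> g \<le> b \<Longrightarrow> down c F g u z"
  by (induction rule: down.induct) (auto intro: down.intros ge_path_mono)

lemma down_ge_trans: "down c F b u v \<Longrightarrow> ge_path F b v z \<Longrightarrow> down c F b u z"
  by (induction rule: down.induct) (auto intro: down.intros ge_path_trans)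

lemma ge_down_trans: "ge_path F b u v \<Longrightarrow> c \<Longrightarrow> down c F b v z \<Longrightarrow> down c F b u z"
  by (induction rule: ge_path.induct) (auto intro: down_hit down_ge)

lemma acc_bound: "acc c F a x y \<Longrightarrow> y < cnt F"
  unfolding acc_def by (blast dest: down_ge ge_path_bounds)

text \<open>A step through \<open>a\<close> goes up along edges labelled above \<open>a\<close> and
  then down along edges labelled at least \<open>a\<close>. All of them lie above \<open>b\<close>,
  so both ends climb to the same node.\<close>

lemma acc_same_rep:
  assumes "wf_frame F" "x < cnt F" "acc c F a x y" "b < a"
  shows "rep F b y = rep F b x"
  using ge_path_rep[of F a "rep F a x" y b] down_ge[of c F a "rep F a x" y] rep_rep[of F x b a] assms
  by (simp add: acc_def)

lemma acc_J:
  assumes "wf_frame F" "x < cnt F" "acc c F a x y" "b < a"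
  shows "acc c F b y z = acc c F b x z"
  using acc_same_rep[OF assms] by (simp add: acc_def)

lemma acc_mono:
  assumes "wf_frame F" "x < cnt F" "acc c F a x z" "b \<le> a" c
  shows "acc c F b x z"
  using assms down_rep[of F "rep F a x" c b z] rep_rep[of F x b a] rep_le[of F a x]
  by (simp add: acc_def down_mono)

text \<open>The climb from \<open>y\<close> uses only edges labelled above \<open>b\<close>, so it
  cannot pass \<open>u\<close>. The edges it removes from the path have labels above
  \<open>a\<close>, hence none is the exact hit required for RJ; for RC the hit may get lost, and
  then \<open>ge_path\<close> is what remains.\<close>

lemma down_lift_rep:
  "wf_frame F \<Longrightarrow> y < cnt F \<Longrightarrow> lab F u \<le> b \<Longrightarrow> a \<le> b \<Longrightarrow> down c F a u y \<or> c \<and> ge_path F a u y \<Longrightarrow>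
   down c F a u (rep F b y) \<or> c \<and> ge_path F a u (rep F b y)"
proof (induction F b y rule: rep.induct)
  case (1 F b y)
  show ?case
  proof (cases "b < lab F y")
    case True
    have p: "par F y < y" using True 1 wf_par[of F y] wf_lab_pos[of F b y] by simp
    have "u \<noteq> y" using True 1 by auto
    moreover have "lab F y \<noteq> a" using True 1 by auto
    ultimately have "down c F a u (par F y) \<or> c \<and> ge_path F a u (par F y)"
      using 1(2,6) down_par[of c F a u y] ge_path_par[of F a u y] by blast
    then show ?thesis using 1 True p by (simp add: rep_gt)
  next
    case False
    then show ?thesis using 1 by (simp add: rep_not_gt)
  qed
qed

text \<open>The label of \<open>rep F a x\<close> is at most \<open>a\<close>, hence at most
  \<open>b\<close>, so the climb from \<open>y\<close> stays below that node and the next descent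
  extends the first one. This gives soundness of \<open>trans4\<close>, of \<open>mon2\<close>, and
  of \<open>mon1\<close> for equal modalities.\<close>

lemma acc_trans_le:
  assumes "wf_frame F" "x < cnt F" "acc c F a x y" "acc c F b y z" "a \<le> b"
  shows "acc c F a x z"
proof -
  let ?u = "rep F a x" and ?w = "rep F b y"
  have y: "y < cnt F" using assms(3) by (rule acc_bound)
  have "lab F ?u \<le> b" using lab_rep_le[of F x a] assms by auto
  then have "down c F a ?u ?w \<or> c \<and> ge_path F a ?u ?w"
    using down_lift_rep[of F y ?u b a c] assms y by (simp add: acc_def)
  moreover have w: "down c F b ?w z" using assms by (simp add: acc_def)
  ultimately show ?thesis using assms(5)
    unfolding acc_def by (meson down_ge_trans ge_down_trans down_ge ge_path_mono down_mono)
qed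

theorem sat_sound:
  "deriv c A B \<Longrightarrow> wf_frame F \<Longrightarrow> x < cnt F \<Longrightarrow> sat c F x A \<Longrightarrow> sat c F x B"
proof (induction arbitrary: x rule: deriv.induct)
  case (nec A B a)
  then show ?case by (auto dest: acc_bound)
next
  case (trans4 a A)
  then show ?case using acc_trans_le[of F x c a _ a] by auto
next
  case (mon1 a b A)
  show ?case
  proof (cases "a = b")
    case True
    then show ?thesis using mon1 acc_trans_le[of F x c a _ a] by auto
  next
    case False
    then show ?thesis using mon1 acc_J[of F x c a _ b] by auto
  qed
next
  case (mon2 a b A)
  then show ?case using acc_trans_le[of F x c b _ a] by auto
next
  case (J a b A B)
  then show ?case using acc_J[of F x c a _ b] by auto
next
  case (C a b A)
  then have "b \<le> a" by simp
  with C show ?case using acc_mono[of F x c a _ b] by auto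
qed auto

section \<open>Completeness: the frame of deductively closed sets\<close>

definition filt :: "bool \<Rightarrow> fm set \<Rightarrow> bool" where
  "filt c X \<longleftrightarrow> Top \<in> X \<and> (\<forall>A B. A \<in> X \<longrightarrow> deriv c A B \<longrightarrow> B \<in> X) \<and> (\<forall>A\<in>X. \<forall>B\<in>X. And A B \<in> X)"

text \<open>The second clause is what J demands of lower diamonds. Its converse, from
  \<open>Y\<close> back to \<open>X\<close>, follows from the first clause and \<open>mon1\<close>;
  \<open>facc_J\<close> relies on it.\<close>

definition facc :: "enat \<Rightarrow> fm set \<Rightarrow> fm set \<Rightarrow> bool" where
  "facc a X Y \<longleftrightarrow> (\<forall>B\<in>Y. Dia a B \<in> X) \<and> (\<forall>b<a. \<forall>C. Dia b C \<in> X \<longrightarrow> Dia b C \<in> Y)"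

lemma filtD: "filt c X \<Longrightarrow> A \<in> X \<Longrightarrow> deriv c A B \<Longrightarrow> B \<in> X"
  by (auto simp: filt_def)

lemma filt_Top: "filt c X \<Longrightarrow> Top \<in> X"
  by (simp only: filt_def)

lemma filt_And: "filt c X \<Longrightarrow> A \<in> X \<Longrightarrow> B \<in> X \<Longrightarrow> And A B \<in> X"
  by (simp only: filt_def)

text \<open>Two nested diamonds imply the one with the smaller label: by \<open>mon1\<close> if the
  inner is smaller, by \<open>mon2\<close> if the outer is.\<close>

lemma facc_trans:
  assumes "filt c X" "facc a X Y" "facc b Y Z"
  shows "facc (min a b) X Z"
proof -
  have "Dia (min a b) B \<in> X" if "B \<in> Z" for B
  proof -
    have "Dia a (Dia b B) \<in> X" using that assms by (auto simp: facc_def)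
    moreover have "deriv c (Dia a (Dia b B)) (Dia (min a b) B)"
      by (metis deriv.mon1 deriv.mon2 linorder_linear min.absorb1 min.absorb2)
    ultimately show ?thesis using assms filtD by blast
  qed
  then show ?thesis using assms by (auto simp: facc_def)
qed

lemma facc_J:
  assumes "filt c X" "facc a X Y" "facc b X Z" "b < a"
  shows "facc b Y Z"
proof -
  have "Dia g C \<in> Z" if "g < b" "Dia g C \<in> Y" for g C
  proof -
    have "Dia a (Dia g C) \<in> X" using that assms by (auto simp: facc_def)
    moreover have "deriv c (Dia a (Dia g C)) (Dia g C)"
      using that assms by (intro deriv.mon1) auto
    ultimately show ?thesis using assms that filtD by (auto simp: facc_def)
  qed
  then show ?thesis using assms by (auto simp: facc_def)
qed

lemma facc_mono:
  assumes "filt True X" "facc a X Y" "b \<le> a"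
  shows "facc b X Y"
proof (cases "b = a")
  case False
  then have "b < a" using assms by auto
  then show ?thesis using assms filtD[OF assms(1) _ deriv.C[of True b a]] by (auto simp: facc_def)
qed (use assms in auto)

lemma deriv_and_mono: "deriv c A A' \<Longrightarrow> deriv c B B' \<Longrightarrow> deriv c (And A B) (And A' B')"
  by (meson deriv.andE1 deriv.andE2 deriv.andI deriv.cut)

lemma deriv_and_assoc: "deriv c (And (And A B) C) (And A (And B C))"
  by (meson deriv.andE1 deriv.andE2 deriv.andI deriv.cut)

text \<open>The formulas \<open>E\<close> below are those that may be added under \<open>Dia a\<close> inside \<open>X\<close>; by axiom \<open>J\<close>
  they include all \<open>Dia b C \<in> X\<close> with \<open>b < a\<close>.\<close>
lemma facc_exists:
  assumes X: "filt c X" and A: "Dia a A \<in> X"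
  obtains Y where "filt c Y" "facc a X Y" "A \<in> Y"
proof -
  define P where "P = (\<lambda>E. \<forall>D. Dia a D \<in> X \<longrightarrow> Dia a (And D E) \<in> X)"
  \<comment> \<open>The filter generated by \<open>A\<close> and the formulas in \<open>P\<close>.
    As \<open>P\<close> contains \<open>Top\<close> and is closed under \<open>And\<close>, a single
    \<open>E\<close> at a time is enough.\<close>
  define Y where "Y = {D. \<exists>E. P E \<and> deriv c (And A E) D}"
  have PT: "P Top" unfolding P_def
    by (metis X filtD deriv.nec deriv.andI deriv.refl deriv.top)
  have PA: "P (And E E')" if "P E" "P E'" for E E'
    unfolding P_def
  proof (intro allI impI)
    fix D assume "Dia a D \<in> X"
    then have "Dia a (And (And D E) E') \<in> X" using that by (auto simp: P_def)
    then show "Dia a (And D (And E E')) \<in> X"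
      by (rule filtD[OF X]) (intro deriv.nec deriv_and_assoc)
  qed
  have PJ: "P (Dia b C)" if "b < a" "Dia b C \<in> X" for b C
    unfolding P_def
  proof (intro allI impI)
    fix D assume "Dia a D \<in> X"
    then have "And (Dia a D) (Dia b C) \<in> X" using that X by (auto simp: filt_def)
    then show "Dia a (And D (Dia b C)) \<in> X"
      by (rule filtD[OF X]) (intro deriv.J that)
  qed
  have "filt c Y"
    unfolding filt_def
  proof (intro conjI allI impI ballI)
    show "Top \<in> Y" using PT by (auto simp: Y_def intro: deriv.top)
  next
    fix B C assume "B \<in> Y" "deriv c B C" then show "C \<in> Y"
      by (auto simp: Y_def intro: deriv.cut)
  next
    fix B C assume "B \<in> Y" "C \<in> Y"
    then obtain E E' where E: "P E" "deriv c (And A E) B" "P E'" "deriv c (And A E') C"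
      by (auto simp: Y_def)
    have "deriv c (And A (And E E')) B" "deriv c (And A (And E E')) C"
      by (rule deriv.cut[OF _ E(2)] deriv.cut[OF _ E(4)],
          intro deriv_and_mono deriv.refl deriv.andE1 deriv.andE2)+
    then show "And B C \<in> Y" using PA[OF E(1) E(3)] by (auto simp: Y_def intro: deriv.andI)
  qed
  moreover have "facc a X Y"
    unfolding facc_def
  proof (intro conjI ballI allI impI)
    fix B assume "B \<in> Y"
    then obtain E where E: "P E" "deriv c (And A E) B" by (auto simp: Y_def)
    then have "Dia a (And A E) \<in> X" using A by (auto simp: P_def)
    then show "Dia a B \<in> X" by (rule filtD[OF X]) (intro deriv.nec E)
  next
    fix b C assume "b < a" "Dia b C \<in> X"
    then show "Dia b C \<in> Y" using PJ by (auto simp: Y_def intro: deriv.andE2)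
  qed
  moreover have "A \<in> Y" using PT by (auto simp: Y_def intro: deriv.andE1)
  ultimately show ?thesis using that by blast
qed

text \<open>Only the bare tree edges have to be respected; that the closure relation
  \<open>acc\<close> is respected as well is a consequence (\<open>fhom_acc\<close>).\<close>

definition fhom :: "bool \<Rightarrow> frame \<Rightarrow> (nat \<Rightarrow> fm set) \<Rightarrow> bool" where
  "fhom c F h \<longleftrightarrow> (\<forall>k<cnt F. filt c (h k))
     \<and> (\<forall>k<cnt F. 0 < k \<longrightarrow> facc (lab F k) (h (par F k)) (h k))
     \<and> (\<forall>(x, p) \<in> set (occ F). Var p \<in> h x)"

text \<open>Iterating \<open>facc_trans\<close>, one may take for \<open>d\<close> the least label
  on the path. The empty path is a case of its own because \<open>facc\<close> need not be
  reflexive.\<close>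

lemma fhom_ge_path:
  assumes "fhom c F h" "wf_frame F" "ge_path F b u z"
  shows "u = z \<or> (\<exists>d\<ge>b. facc d (h u) (h z))"
  using assms(3)
proof (induction rule: ge_path.induct)
  case (ge_step v z)
  have f: "facc (lab F v) (h (par F v)) (h v)" "filt c (h (par F v))"
    using assms ge_step wf_par[of F v] by (auto simp: fhom_def)
  then show ?case
    using ge_step facc_trans[OF f(2,1), of _ "h z"] by (metis min.bounded_iff)
qed simp

text \<open>The least label of the path is exactly \<open>b\<close> for RJ; for RC it may exceed
  \<open>b\<close>, and axiom C, through \<open>facc_mono\<close>, lowers it.\<close>

lemma fhom_down:
  assumes "fhom c F h" "wf_frame F" "down c F b u z"
  shows "facc b (h u) (h z)"
  using assms(3)
proof (induction rule: down.induct)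
  case (down_hit v z)
  have f: "facc (lab F v) (h (par F v)) (h v)" "filt c (h (par F v))"
    using assms down_hit wf_par[of F v] by (auto simp: fhom_def)
  have "\<exists>d\<ge>b. (c \<or> d = b) \<and> facc d (h (par F v)) (h z)"
    using fhom_ge_path[OF assms(1,2) down_hit(5)]
  proof
    assume "v = z" then show ?thesis using f down_hit by auto
  next
    assume "\<exists>d\<ge>b. facc d (h v) (h z)"
    then obtain d where d: "d \<ge> b" "facc d (h v) (h z)" by blast
    then show ?thesis using facc_trans[OF f(2,1) d(2)] down_hit
      by (intro exI[of _ "min (lab F v) d"]) auto
  qed
  then show ?case using f(2) facc_mono by (cases c) auto
next
  case (down_step v z)
  have f: "facc (lab F v) (h (par F v)) (h v)" "filt c (h (par F v))"
    using assms down_step wf_par[of F v] by (auto simp: fhom_def)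
  then show ?case using facc_trans[OF f(2,1) down_step(5)] down_step by (simp add: min_def split: if_splits)
qed

text \<open>The climb is undone edge by edge: the image of the parent reaches the image of
  \<open>z\<close> through \<open>b\<close> and that of \<open>x\<close> through a larger label, so
  \<open>facc_J\<close> transfers the \<open>b\<close>-step to \<open>x\<close>.\<close>

lemma fhom_acc:
  "wf_frame F \<Longrightarrow> fhom c F h \<Longrightarrow> x < cnt F \<Longrightarrow> acc c F b x z \<Longrightarrow> facc b (h x) (h z)"
proof (induction F b x rule: rep.induct)
  case (1 F b x)
  show ?case
  proof (cases "b < lab F x")
    case True
    have x: "0 < x" and p: "par F x < x" using True 1 wf_par[of F x] wf_lab_pos[of F b x] by auto
    have "acc c F b (par F x) z" using True 1 by (simp add: acc_def rep_gt)
    then have "facc b (h (par F x)) (h z)" using 1 True p by simp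
    moreover have "facc (lab F x) (h (par F x)) (h x)" "filt c (h (par F x))"
      using 1 x p by (auto simp: fhom_def)
    ultimately show ?thesis using facc_J True by blast
  next
    case False
    then show ?thesis using 1 by (auto simp: rep_not_gt acc_def intro: fhom_down)
  qed
qed

text \<open>Formulas are positive, so truth travels along homomorphisms and no converse is
  required.\<close>

lemma fhom_sat:
  "wf_frame F \<Longrightarrow> fhom c F h \<Longrightarrow> x < cnt F \<Longrightarrow> sat c F x B \<Longrightarrow> B \<in> h x"
proof (induction B arbitrary: x)
  case (Var p)
  have "\<forall>(y, q) \<in> set (occ F). Var q \<in> h y" using Var.prems(2) by (simp add: fhom_def)
  moreover have "(x, p) \<in> set (occ F)" using Var.prems(4) by (simp only: sat.simps)
  ultimately show ?case by blast
next
  case Top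
  then show ?case using filt_Top[of c "h x"] by (simp add: fhom_def)
next
  case (And B1 B2)
  have "filt c (h x)" using And.prems by (simp add: fhom_def)
  moreover have "B1 \<in> h x" "B2 \<in> h x" using And by simp_all
  ultimately show ?case by (rule filt_And)
next
  case (Dia a B)
  from Dia.prems(4) obtain z where z: "acc c F a x z" "sat c F z B" by auto
  have "B \<in> h z" by (rule Dia.IH[OF Dia.prems(1,2) acc_bound[OF z(1)] z(2)])
  moreover have "facc a (h x) (h z)" by (rule fhom_acc[OF Dia.prems(1-3) z(1)])
  ultimately show ?case by (simp add: facc_def)
qed

section \<open>The tree of a formula\<close>

fun build :: "fm \<Rightarrow> nat \<Rightarrow> frame \<Rightarrow> frame" where
  "build (Var p) x F = F\<lparr>occ := occ F @ [(x, p)]\<rparr>"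
| "build Top x F = F"
| "build (And A B) x F = build B x (build A x F)"
| "build (Dia a A) x F = build A (cnt F)
     (F\<lparr>cnt := Suc (cnt F), par := (par F)(cnt F := x), lab := (lab F)(cnt F := a)\<rparr>)"

definition root_frame :: frame where
  "root_frame = \<lparr>cnt = 1, par = (\<lambda>_. 0), lab = (\<lambda>_. 0), occ = []\<rparr>"

definition extends :: "frame \<Rightarrow> frame \<Rightarrow> bool" where
  "extends F G \<longleftrightarrow> cnt F \<le> cnt G \<and> (\<forall>k<cnt F. par G k = par F k \<and> lab G k = lab F k)
     \<and> set (occ F) \<subseteq> set (occ G)"

lemma extends_trans: "extends F G \<Longrightarrow> extends G H \<Longrightarrow> extends F H"
  by (auto simp: extends_def)

lemma extends_build: "extends F (build A x F)"
proof (induction A arbitrary: x F)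
  case (And A B)
  then show ?case by (metis build.simps(3) extends_trans)
next
  case (Dia a A)
  show ?case
    by (simp, rule extends_trans[OF _ Dia]) (auto simp: extends_def)
qed (auto simp: extends_def)

lemma wf_build: "wf_frame F \<Longrightarrow> x < cnt F \<Longrightarrow> wf_frame (build A x F)"
proof (induction A arbitrary: x F)
  case (And A B)
  have "x < cnt (build A x F)" using extends_build[of F A x] And.prems by (simp add: extends_def)
  then show ?case using And by simp
next
  case (Dia a A)
  show ?case
    unfolding build.simps
    by (rule Dia.IH) (use Dia.prems in \<open>auto simp: wf_frame_def less_Suc_eq\<close>)
qed (auto simp: wf_frame_def)

lemma wf_root_frame: "wf_frame root_frame"
  by (auto simp: wf_frame_def root_frame_def)

text \<open>An arbitrary well-formed extension \<open>G\<close> is allowed because construction goes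
  on after the subtree of \<open>A\<close> is complete.\<close>

lemma sat_build: "x < cnt F \<Longrightarrow> wf_frame G \<Longrightarrow> extends (build A x F) G \<Longrightarrow> sat c G x A"
proof (induction A arbitrary: x F)
  case (And A B)
  have "x < cnt (build A x F)" using extends_build[of F A x] And.prems by (simp add: extends_def)
  moreover have "extends (build A x F) G"
    using extends_trans[OF extends_build] And.prems by auto
  ultimately show ?case using And by auto
next
  case (Dia a A)
  let ?F = "F\<lparr>cnt := Suc (cnt F), par := (par F)(cnt F := x), lab := (lab F)(cnt F := a)\<rparr>"
  have "extends ?F G" using extends_trans[OF extends_build] Dia.prems by auto
  then have k: "cnt F < cnt G" "par G (cnt F) = x" "lab G (cnt F) = a"
    by (auto simp: extends_def)
  have "sat c G (cnt F) A" using Dia.prems by (intro Dia.IH[of _ ?F]) auto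
  moreover have "down c G a x (cnt F)"
    using down_hit[of "cnt F" G a c "cnt F"] k Dia.prems by (auto intro: ge_refl)
  then have "acc c G a x (cnt F)"
    unfolding acc_def using Dia.prems k by (intro down_rep) auto
  ultimately show ?case by auto
qed (auto simp: extends_def)

text \<open>Each new node needs an image below that of its parent, and \<open>facc_exists\<close>
  supplies it.\<close>

lemma fhom_build:
  "wf_frame F \<Longrightarrow> fhom c F h \<Longrightarrow> x < cnt F \<Longrightarrow> A \<in> h x \<Longrightarrow>
    \<exists>h'. fhom c (build A x F) h' \<and> (\<forall>k<cnt F. h' k = h k)"
proof (induction A arbitrary: x F h)
  case (Var p)
  then show ?case by (intro exI[of _ h]) (auto simp: fhom_def)
next
  case Top
  then show ?case by auto
next
  case (And A B)
  have AB: "A \<in> h x" "B \<in> h x"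
    using And.prems filtD[OF _ And.prems(4)] deriv.andE1 deriv.andE2 by (auto simp: fhom_def)
  obtain h1 where h1: "fhom c (build A x F) h1" "\<forall>k<cnt F. h1 k = h k"
    using And AB by blast
  have e: "cnt F \<le> cnt (build A x F)" using extends_build[of F A x] by (simp add: extends_def)
  then obtain h2 where "fhom c (build B x (build A x F)) h2" "\<forall>k<cnt (build A x F). h2 k = h1 k"
    using And.IH(2)[of "build A x F" h1 x] And.prems h1 AB wf_build by auto
  then show ?case using e h1 by (intro exI[of _ h2]) auto
next
  case (Dia a A)
  let ?F = "F\<lparr>cnt := Suc (cnt F), par := (par F)(cnt F := x), lab := (lab F)(cnt F := a)\<rparr>"
  obtain Y where Y: "filt c Y" "facc a (h x) Y" "A \<in> Y"
    using facc_exists[of c "h x" a A] Dia.prems by (auto simp: fhom_def)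
  let ?h = "h(cnt F := Y)"
  have wf: "wf_frame ?F" using Dia.prems by (auto simp: wf_frame_def less_Suc_eq)
  have hom: "fhom c ?F ?h"
  proof -
    have "par F k \<noteq> cnt F" if "0 < k" "k < cnt F" for k
      using wf_par[OF Dia.prems(1) that] that by simp
    moreover have "x' \<noteq> cnt F" if "(x', p) \<in> set (occ F)" for x' p
      using Dia.prems(1) that by (auto simp: wf_frame_def)
    ultimately show ?thesis using Dia.prems(2,3) Y
      unfolding fhom_def by (auto simp: less_Suc_eq)
  qed
  have "\<exists>h'. fhom c (build A (cnt F) ?F) h' \<and> (\<forall>k<cnt ?F. h' k = ?h k)"
    by (rule Dia.IH[OF wf hom]) (use Y in auto)
  then obtain h' where "fhom c (build A (cnt F) ?F) h'" "\<forall>k<cnt ?F. h' k = ?h k"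
    by blast
  then show ?case by (intro exI[of _ h']) auto
qed

theorem deriv_iff_sat: "deriv c A B \<longleftrightarrow> sat c (build A 0 root_frame) 0 B"
proof
  let ?F = "build A 0 root_frame"
  have c0: "0 < cnt root_frame" by (simp add: root_frame_def)
  have wf: "wf_frame ?F" using wf_build wf_root_frame c0 by blast
  have c1: "0 < cnt ?F" using wf by (simp add: wf_frame_def)
  show "sat c ?F 0 B" if "deriv c A B"
  proof (rule sat_sound[OF that wf c1])
    show "sat c ?F 0 A"
      by (rule sat_build[OF c0 wf]) (auto simp: extends_def)
  qed
  show "deriv c A B" if "sat c ?F 0 B"
  proof -
    \<comment> \<open>All consequences of \<open>A\<close>, so that membership in the image of the
      root is derivability from \<open>A\<close>.\<close>
    define h where "h = (\<lambda>_::nat. {D. deriv c A D})"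
    have "fhom c root_frame h"
      by (auto simp: fhom_def root_frame_def h_def filt_def intro: deriv.intros)
    moreover have "A \<in> h 0" by (simp add: h_def deriv.refl)
    ultimately obtain h' where "fhom c ?F h'" "h' 0 = h 0"
      using fhom_build[OF wf_root_frame _ c0] c0 by blast
    then have "B \<in> h 0" using fhom_sat[OF wf _ c1 that] by auto
    then show ?thesis by (simp add: h_def)
  qed
qed

section \<open>A while language compiled to the machine\<close>

text \<open>The flag of \<open>AIn\<close> fixes in the program text from which of two places the
  symbol is fetched. As \<open>aok\<close> demands that it agree with the position, programs branch
  on the position first.\<close>

datatype aop =
    AConst nat nat
  | AAdd nat nat nat
  | ASub nat nat nat
  | AGet nat nat nat
  | APut nat nat nat
  | AIn bool nat nat

datatype com =
    Op aop
  | Seq com com (infixr \<open>;;\<close> 60)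
  | Cond nat com com
  | Loop nat com

type_synonym mem = "nat \<Rightarrow> nat"
type_synonym store = "mem \<times> (nat \<Rightarrow> mem)"

fun aex :: "nat list \<Rightarrow> aop \<Rightarrow> store \<Rightarrow> store" where
  "aex w (AConst x n) (r, a) = (r(x := n), a)"
| "aex w (AAdd x y z) (r, a) = (r(x := r y + r z), a)"
| "aex w (ASub x y z) (r, a) = (r(x := r y - r z), a)"
| "aex w (AGet x j y) (r, a) = (r(x := a j (r y)), a)"
| "aex w (APut j y x) (r, a) = (r, a(j := (a j)(r y := r x)))"
| "aex w (AIn low x y) (r, a) = (r(x := w ! (r y - 1)), a)"

fun aok :: "nat list \<Rightarrow> aop \<Rightarrow> store \<Rightarrow> bool" where
  "aok w (AIn low x y) (r, a) = (1 \<le> r y \<and> r y \<le> length w \<and> (low \<longleftrightarrow> r y \<le> 30))"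
| "aok w _ s = True"

inductive bs :: "nat list \<Rightarrow> com \<Rightarrow> store \<Rightarrow> nat \<Rightarrow> store \<Rightarrow> bool" for w where
  bs_op: "aok w i s \<Longrightarrow> bs w (Op i) s 1 (aex w i s)"
| bs_seq: "bs w c1 s t1 s1 \<Longrightarrow> bs w c2 s1 t2 s2 \<Longrightarrow> bs w (c1 ;; c2) s (t1 + t2) s2"
| bs_cond0: "fst s x = 0 \<Longrightarrow> bs w c1 s t s1 \<Longrightarrow> bs w (Cond x c1 c2) s (t + 1) s1"
| bs_cond1: "fst s x \<noteq> 0 \<Longrightarrow> bs w c2 s t s1 \<Longrightarrow> bs w (Cond x c1 c2) s (t + 1) s1"
| bs_loop0: "fst s x = 0 \<Longrightarrow> bs w (Loop x c) s 1 s"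
| bs_loop1: "fst s x \<noteq> 0 \<Longrightarrow> bs w c s t1 s1 \<Longrightarrow> bs w (Loop x c) s1 t2 s2
    \<Longrightarrow> bs w (Loop x c) s (t1 + t2 + 1) s2"

section \<open>Total correctness with a time bound\<close>

definition wp :: "nat list \<Rightarrow> com \<Rightarrow> store \<Rightarrow> nat \<Rightarrow> (store \<Rightarrow> bool) \<Rightarrow> bool" where
  "wp w c s T Q \<longleftrightarrow> (\<exists>t s'. bs w c s t s' \<and> t \<le> T \<and> Q s')"

fun vc :: "nat list \<Rightarrow> com \<Rightarrow> (store \<Rightarrow> bool) \<Rightarrow> store \<Rightarrow> bool" where
  "vc w (Op i) Q s = (aok w i s \<and> Q (aex w i s))"
| "vc w (c1 ;; c2) Q s = vc w c1 (vc w c2 Q) s"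
| "vc w (Cond x c1 c2) Q s = (if fst s x = 0 then vc w c1 Q s else vc w c2 Q s)"
| "vc w (Loop x c) Q s = False"

text \<open>A bound independent of the state: both branches of a conditional are charged. The value
  0 for loops is safe because \<open>vc\<close> is \<open>False\<close> on them.\<close>

fun cost :: "com \<Rightarrow> nat" where
  "cost (Op i) = 1"
| "cost (c1 ;; c2) = cost c1 + cost c2"
| "cost (Cond x c1 c2) = cost c1 + cost c2 + 1"
| "cost (Loop x c) = 0"

lemma wp_mono: "wp w c s T Q \<Longrightarrow> T \<le> T' \<Longrightarrow> (\<And>s'. Q s' \<Longrightarrow> Q' s') \<Longrightarrow> wp w c s T' Q'"
  unfolding wp_def by (meson le_trans)

lemma wp_seq:
  "wp w c1 s T1 (\<lambda>s1. wp w c2 s1 T2 Q) \<Longrightarrow> T1 + T2 \<le> T \<Longrightarrow> wp w (c1 ;; c2) s T Q"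
  unfolding wp_def by (meson bs_seq add_mono le_trans)

lemma wp_cond:
  assumes "fst s x = 0 \<Longrightarrow> wp w c1 s T Q" "fst s x \<noteq> 0 \<Longrightarrow> wp w c2 s T Q" "T + 1 \<le> T'"
  shows "wp w (Cond x c1 c2) s T' Q"
proof (cases "fst s x = 0")
  case True
  then obtain t s' where "bs w c1 s t s'" "t \<le> T" "Q s'" using assms(1) by (auto simp: wp_def)
  then show ?thesis using bs_cond0[OF True] assms(3) unfolding wp_def
    by (intro exI[of _ "t + 1"] exI[of _ s']) auto
next
  case False
  then obtain t s' where "bs w c2 s t s'" "t \<le> T" "Q s'" using assms(2) by (auto simp: wp_def)
  then show ?thesis using bs_cond1[of s x w c2, OF False] assms(3) unfolding wp_def
    by (intro exI[of _ "t + 1"] exI[of _ s']) auto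
qed

lemma vc_wp: "vc w c Q s \<Longrightarrow> wp w c s (cost c) Q"
proof (induction c arbitrary: s Q)
  case (Op i)
  then show ?case unfolding wp_def
    by (intro exI[of _ 1] exI[of _ "aex w i s"]) (auto intro: bs_op[simplified])
next
  case (Seq c1 c2)
  have "wp w c1 s (cost c1) (vc w c2 Q)" using Seq by simp
  then show ?case by (intro wp_seq[of w c1 s "cost c1" c2 "cost c2"]) (auto intro: wp_mono Seq.IH(2))
next
  case (Cond x c1 c2)
  show ?case
  proof (rule wp_cond[of _ _ _ _ "cost c1 + cost c2"])
    show "wp w c1 s (cost c1 + cost c2) Q" if "fst s x = 0"
      using Cond.prems that by (intro wp_mono[OF Cond.IH(1)]) auto
    show "wp w c2 s (cost c1 + cost c2) Q" if "fst s x \<noteq> 0"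
      using Cond.prems that by (intro wp_mono[OF Cond.IH(2)]) auto
  qed simp
qed simp

lemma wp_vc: "vc w c Q s \<Longrightarrow> cost c \<le> T \<Longrightarrow> wp w c s T Q"
  using vc_wp wp_mono by blast

text \<open>The index of the invariant is the number of rounds left, so one index yields both
  termination and the time bound.\<close>

lemma wp_loop:
  assumes step: "\<And>n s. I (Suc n) s \<Longrightarrow> fst s x \<noteq> 0 \<and> wp w c s Tb (I n)"
    and zero: "\<And>s. I 0 s \<Longrightarrow> fst s x = 0"
  shows "I n s \<Longrightarrow> n * (Tb + 1) + 1 \<le> T \<Longrightarrow> wp w (Loop x c) s T (I 0)"
proof (induction n arbitrary: s T)
  case 0
  then show ?case using zero bs_loop0[of s x w c] unfolding wp_def
    by (intro exI[of _ 1] exI[of _ s]) auto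
next
  case (Suc n)
  obtain t1 s1 where 1: "bs w c s t1 s1" "t1 \<le> Tb" "I n s1" and x: "fst s x \<noteq> 0"
    using step[OF Suc.prems(1)] by (auto simp: wp_def)
  obtain t2 s2 where 2: "bs w (Loop x c) s1 t2 s2" "t2 \<le> n * (Tb + 1) + 1" "I 0 s2"
    using Suc.IH[OF 1(3) order_refl] by (auto simp: wp_def)
  show ?case unfolding wp_def
    by (rule exI[of _ "t1 + t2 + 1"], rule exI[of _ s2])
      (use bs_loop1[OF x 1(1) 2(1)] 1 2 Suc.prems(2) in auto)
qed

lemma wp_seqI:
  "wp w c1 s T1 R \<Longrightarrow> (\<And>r a. R (r, a) \<Longrightarrow> wp w c2 (r, a) T2 Q) \<Longrightarrow> T1 + T2 \<le> T \<Longrightarrow> wp w (c1 ;; c2) s T Q"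
  by (rule wp_seq[of w c1 s T1 c2 T2]) (auto intro: wp_mono)

lemma wp_loopI:
  assumes "\<And>n r a. I (Suc n) r a \<Longrightarrow> r x \<noteq> 0 \<and> vc w c (\<lambda>(r', a'). I n r' a') (r, a)"
    and "\<And>r a. I 0 r a \<Longrightarrow> r x = 0" and "I n r a" and "n * (cost c + 1) + 1 \<le> T"
  shows "wp w (Loop x c) (r, a) T (\<lambda>(r', a'). I 0 r' a')"
proof (rule wp_loop[where I = "\<lambda>n (r, a). I n r a" and n = n])
  fix n and s :: store
  assume "(\<lambda>(r, a). I (Suc n) r a) s"
  then show "fst s x \<noteq> 0 \<and> wp w c s (cost c) (\<lambda>(r, a). I n r a)"
    using assms(1) by (cases s) (auto intro: vc_wp)
qed (use assms in auto)

text \<open>Machine cell 0 holds a base address beyond the input and cells 1, 2 are scratch; cell \<open>i + 3\<close> is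
  register \<open>i\<close>, and the eight arrays are interleaved above the base address. The first 30 input
  symbols, whose cells become registers, are kept just below the base address.\<close>

definition base :: "nat list \<Rightarrow> nat" where
  "base w = 32 * length w + 29"

text \<open>Three doublings replace the multiplication by 8; \<open>j + 1\<close> selects the array,
  and cell 0 contributes the base address.\<close>

definition addr_code :: "nat \<Rightarrow> nat \<Rightarrow> instr list" where
  "addr_code j y = [Add 1 (y + 3) (y + 3), Add 1 1 1, Add 1 1 1, Const 2 (j + 1), Add 1 1 2, Add 1 1 0]"

fun op_code :: "aop \<Rightarrow> instr list" where
  "op_code (AConst x n) = [Const (x + 3) n]"
| "op_code (AAdd x y z) = [Add (x + 3) (y + 3) (z + 3)]"
| "op_code (ASub x y z) = [Sub (x + 3) (y + 3) (z + 3)]"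
| "op_code (AGet x j y) = addr_code j y @ [Load (x + 3) 1]"
| "op_code (APut j y x) = addr_code j y @ [Store 1 (x + 3)]"
| "op_code (AIn low x y) =
    (if low then [Const 1 30, Sub 1 0 1, Add 1 1 (y + 3), Load (x + 3) 1] else [Load (x + 3) (y + 3)])"

text \<open>The 28 registers are the cells 3 to 30; with the two scratch cells they take exactly the
  cells of the first 30 symbols.\<close>

fun op_wf :: "aop \<Rightarrow> bool" where
  "op_wf (AConst x n) = (x < 28)"
| "op_wf (AAdd x y z) = (x < 28 \<and> y < 28 \<and> z < 28)"
| "op_wf (ASub x y z) = (x < 28 \<and> y < 28 \<and> z < 28)"
| "op_wf (AGet x j y) = (x < 28 \<and> j < 8 \<and> y < 28)"
| "op_wf (APut j y x) = (x < 28 \<and> j < 8 \<and> y < 28)"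
| "op_wf (AIn low x y) = (x < 28 \<and> y < 28)"

fun com_wf :: "com \<Rightarrow> bool" where
  "com_wf (Op i) = op_wf i"
| "com_wf (c1 ;; c2) = (com_wf c1 \<and> com_wf c2)"
| "com_wf (Cond x c1 c2) = (x < 28 \<and> com_wf c1 \<and> com_wf c2)"
| "com_wf (Loop x c) = (x < 28 \<and> com_wf c)"

fun compile :: "nat \<Rightarrow> com \<Rightarrow> instr list" where
  "compile pc (Op i) = op_code i"
| "compile pc (c1 ;; c2) = (let p1 = compile pc c1 in p1 @ compile (pc + length p1) c2)"
| "compile pc (Cond x c1 c2) =
    (let p2 = compile (pc + 1) c2; l1 = pc + 1 + length p2 + 1; p1 = compile l1 c1
     in Jz (x + 3) l1 # p2 @ Jmp (l1 + length p1) # p1)"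
| "compile pc (Loop x c) =
    (let p = compile (pc + 1) c in Jz (x + 3) (pc + length p + 2) # p @ [Jmp pc])"

section \<open>Simulation of commands by machine code\<close>

definition mrel :: "nat list \<Rightarrow> mem \<Rightarrow> store \<Rightarrow> bool" where
  "mrel w m s \<longleftrightarrow> m 0 = base w \<and> (\<forall>i<28. m (i + 3) = fst s i)
     \<and> (\<forall>j<8. \<forall>i. m (base w + 1 + j + 8 * i) = snd s j i)
     \<and> (\<forall>i. 1 \<le> i \<and> i \<le> length w \<and> i \<le> 30 \<longrightarrow> m (base w - 30 + i) = w ! (i - 1))
     \<and> (\<forall>i. 30 < i \<and> i \<le> length w \<longrightarrow> m i = w ! (i - 1))"

definition straight :: "instr \<Rightarrow> bool" where
  "straight i = (case i of Jz _ _ \<Rightarrow> False | Jmp _ \<Rightarrow> False | Halt \<Rightarrow> False | _ \<Rightarrow> True)"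

fun mexec :: "instr list \<Rightarrow> mem \<Rightarrow> mem" where
  "mexec [] m = m"
| "mexec (i # is) m = mexec is (snd (exec i (0, m)))"

definition code_at :: "instr list \<Rightarrow> nat \<Rightarrow> instr list \<Rightarrow> bool" where
  "code_at P pc is \<longleftrightarrow> (\<exists>xs ys. P = xs @ is @ ys \<and> length xs = pc)"

lemma code_at_mid: "length xs = pc \<Longrightarrow> code_at (xs @ is @ ys) pc is"
  unfolding code_at_def by blast

lemma code_at_Cons:
  "code_at P pc (i # is) \<longleftrightarrow> pc < length P \<and> P ! pc = i \<and> code_at P (pc + 1) is"
proof
  assume "code_at P pc (i # is)"
  then obtain xs ys where "P = xs @ (i # is) @ ys" "length xs = pc" by (auto simp: code_at_def)
  moreover from this have "P = (xs @ [i]) @ is @ ys" "length (xs @ [i]) = pc + 1" by auto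
  then have "code_at P (pc + 1) is" unfolding code_at_def by blast
  ultimately show "pc < length P \<and> P ! pc = i \<and> code_at P (pc + 1) is" by auto
next
  assume a: "pc < length P \<and> P ! pc = i \<and> code_at P (pc + 1) is"
  then obtain xs ys where P: "P = xs @ is @ ys" "length xs = pc + 1" by (auto simp: code_at_def)
  then obtain xs' x where xs: "xs = xs' @ [x]" "length xs' = pc"
    by (metis Suc_eq_plus1 length_Suc_conv_rev)
  then have "x = i" using a P by (auto simp: nth_append)
  then show "code_at P pc (i # is)" using P xs by (auto simp: code_at_def)
qed

lemma code_at_append:
  "code_at P pc (is @ js) \<longleftrightarrow> code_at P pc is \<and> code_at P (pc + length is) js"
proof (induction "is" arbitrary: pc)
  case Nil
  then show ?case by (auto simp: code_at_def intro: exI[of _ "[]"])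
next
  case (Cons i "is")
  then show ?case by (simp add: code_at_Cons)
qed

lemma run_add: "run P (s + t) cf = run P t (run P s cf)"
  by (metis add.commute comp_apply funpow_add run_def)

lemma run_0: "run P 0 cf = cf"
  by (simp add: run_def)

lemma run_1: "run P 1 cf = step P cf"
  by (simp add: run_def)

lemma step_at: "pc < length P \<Longrightarrow> P ! pc = i \<Longrightarrow> i \<noteq> Halt \<Longrightarrow> step P (pc, m) = exec i (pc, m)"
  by (simp add: step_def halted_def)

lemma exec_straight: "straight i \<Longrightarrow> exec i (pc, m) = (pc + 1, snd (exec i (0, m)))"
  by (cases i) (auto simp: straight_def)

lemma run_straight:
  "code_at P pc is \<Longrightarrow> (\<forall>i\<in>set is. straight i) \<Longrightarrow>
    run P (length is) (pc, m) = (pc + length is, mexec is m)"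
proof (induction "is" arbitrary: pc m)
  case Nil
  then show ?case by (simp add: run_0)
next
  case (Cons i "is")
  then have "step P (pc, m) = exec i (pc, m)"
    by (intro step_at) (auto simp: code_at_Cons straight_def)
  also have "\<dots> = (pc + 1, snd (exec i (0, m)))" using Cons.prems(2) by (intro exec_straight) simp
  finally have "run P (1 + length is) (pc, m) = run P (length is) (pc + 1, snd (exec i (0, m)))"
    by (simp only: run_add run_1)
  then show ?case using Cons by (simp add: code_at_Cons)
qed

lemma straight_op: "i \<in> set (op_code p) \<Longrightarrow> straight i"
  by (cases p) (auto simp: straight_def addr_code_def split: if_splits)

lemma length_op_code: "length (op_code p) \<le> 7"
  by (cases p) (auto simp: addr_code_def)

lemma mexec_append: "mexec (is @ js) m = mexec js (mexec is m)"
  by (induction "is" arbitrary: m) auto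

lemma mexec_addr:
  assumes "mrel w m (r, a)" "y < 28"
  shows "mexec (addr_code j y) m = m(1 := base w + 1 + j + 8 * r y, 2 := j + 1)"
  using assms by (auto simp: addr_code_def mrel_def fun_eq_iff)

lemma base_ge: "1 \<le> length w \<Longrightarrow> 61 \<le> base w" "length w < base w"
  by (auto simp: base_def)

lemma mrel_scratch: "mrel w m s \<Longrightarrow> 1 \<le> length w \<Longrightarrow> mrel w (m(1 := u, 2 := v)) s"
  using base_ge[of w] by (auto simp: mrel_def)

lemma mrel_reg:
  assumes "mrel w m (r, a)" "x < 28" "1 \<le> length w"
  shows "mrel w (m(x + 3 := v)) (r(x := v), a)"
  using assms base_ge[of w] by (auto simp: mrel_def)

lemma mrel_put:
  assumes m: "mrel w m (r, a)" and j: "j < 8" and w: "1 \<le> length w"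
  shows "mrel w (m(base w + 1 + j + 8 * k := v)) (r, a(j := (a j)(k := v)))"
proof -
  \<comment> \<open>Remainders modulo 8 keep the interleaved arrays apart.\<close>
  have "j' = j \<and> i = k" if "base w + 1 + j' + 8 * i = base w + 1 + j + 8 * k" "j' < 8" for j' i
    using that j by presburger
  then have arr: "(m(base w + 1 + j + 8 * k := v)) (base w + 1 + j' + 8 * i) = (a(j := (a j)(k := v))) j' i"
    if "j' < 8" for j' i
    using m that by (auto simp: mrel_def)
  have low: "(m(base w + 1 + j + 8 * k := v)) i = m i" if "i \<le> base w" for i
    using that by simp
  show ?thesis
    unfolding mrel_def fst_conv snd_conv
  proof (intro conjI allI impI)
    show "(m(base w + 1 + j + 8 * k := v)) (base w + 1 + j' + 8 * i) = (a(j := (a j)(k := v))) j' i"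
      if "j' < 8" for j' i using that by (rule arr)
  qed (subst low; use m base_ge[of w] w in \<open>auto simp: mrel_def\<close>)+
qed

lemma mrel_op:
  assumes m: "mrel w m s" and ok: "aok w p s" and wf: "op_wf p" and w: "1 \<le> length w"
  shows "mrel w (mexec (op_code p) m) (aex w p s)"
proof -
  obtain r a where s: "s = (r, a)" by (cases s)
  note m' = m[unfolded s]
  have reg: "m (i + 3) = r i" if "i < 28" for i using m' that by (simp add: mrel_def)
  show ?thesis
  proof (cases p)
    case (AGet x j y)
    let ?m = "m(1 := base w + 1 + j + 8 * r y, 2 := j + 1)"
    have "?m (base w + 1 + j + 8 * r y) = a j (r y)"
      using m' wf AGet base_ge[of w] w by (auto simp: mrel_def)
    then have "mexec (op_code p) m = ?m(x + 3 := a j (r y))"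
      using AGet wf mexec_addr[OF m', of y j] by (simp add: mexec_append)
    then show ?thesis using mrel_reg[OF mrel_scratch[OF m' w]] AGet wf w s by simp
  next
    case (APut j y x)
    let ?m = "m(1 := base w + 1 + j + 8 * r y, 2 := j + 1)"
    have "mexec (op_code p) m = ?m(base w + 1 + j + 8 * r y := r x)"
      using APut wf mexec_addr[OF m', of y j] reg[of x] by (simp add: mexec_append)
    then show ?thesis using mrel_put[OF mrel_scratch[OF m' w]] APut wf w s by simp
  next
    case (AIn low x y)
    show ?thesis
    proof (cases low)
      case True
      let ?m = "m(1 := base w - 30 + r y, 2 := m 2)"
      have "m (base w - 30 + r y) = w ! (r y - 1)"
        using m' ok AIn s True by (auto simp: mrel_def)
      then have "mexec (op_code p) m = ?m(x + 3 := w ! (r y - 1))"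
        using AIn wf True reg[of y] m' base_ge[of w] w by (auto simp: mrel_def)
      then show ?thesis using mrel_reg[OF mrel_scratch[OF m' w]] AIn wf w s by simp
    next
      case False
      have "m (r y) = w ! (r y - 1)"
        using m' ok AIn s False by (auto simp: mrel_def)
      then have "mexec (op_code p) m = m(x + 3 := w ! (r y - 1))"
        using AIn wf False reg[of y] by simp
      then show ?thesis using mrel_reg[OF m'] AIn wf w s by simp
    qed
  qed (use wf w s reg mrel_reg[OF m'] in auto)
qed

text \<open>Seven is the length of the longest \<open>op_code\<close>: six instructions for the
  address and one access. A test together with its closing jump takes at most two machine steps,
  which the one unit charged for it covers.\<close>

lemma compile_sim:
  "bs w c s t s' \<Longrightarrow> 1 \<le> length w \<Longrightarrow> com_wf c \<Longrightarrow> code_at P pc (compile pc c) \<Longrightarrow> mrel w m s \<Longrightarrow>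
    \<exists>t' m'. t' \<le> 7 * t \<and> run P t' (pc, m) = (pc + length (compile pc c), m') \<and> mrel w m' s'"
proof (induction arbitrary: pc m rule: bs.induct)
  case (bs_op i s)
  show ?case
    by (rule exI[of _ "length (op_code i)"], rule exI[of _ "mexec (op_code i) m"])
      (use bs_op length_op_code[of i] in \<open>auto simp: run_straight straight_op mrel_op\<close>)
next
  case (bs_seq c1 s t1 s1 c2 t2 s2)
  let ?pc = "pc + length (compile pc c1)"
  have code: "code_at P pc (compile pc c1)" "code_at P ?pc (compile ?pc c2)"
    using bs_seq.prems by (auto simp: Let_def code_at_append)
  obtain t1' m1 where 1: "t1' \<le> 7 * t1" "run P t1' (pc, m) = (?pc, m1)" "mrel w m1 s1"
    using bs_seq.IH(1)[OF bs_seq.prems(1) _ code(1) bs_seq.prems(4)] bs_seq.prems(2) by auto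
  obtain t2' m2 where 2: "t2' \<le> 7 * t2" "run P t2' (?pc, m1) = (?pc + length (compile ?pc c2), m2)"
    "mrel w m2 s2"
    using bs_seq.IH(2)[OF bs_seq.prems(1) _ code(2) 1(3)] bs_seq.prems(2) by auto
  show ?case
    by (rule exI[of _ "t1' + t2'"], rule exI[of _ m2])
      (use 1 2 in \<open>auto simp: Let_def run_add\<close>)
next
  case (bs_cond0 s x c1 t s1 c2)
  define p2 where "p2 = compile (pc + 1) c2"
  define l1 where "l1 = pc + 1 + length p2 + 1"
  have eq: "compile pc (Cond x c1 c2) = Jz (x + 3) l1 # p2 @ Jmp (l1 + length (compile l1 c1)) # compile l1 c1"
    by (simp add: Let_def p2_def l1_def)
  have code: "pc < length P" "P ! pc = Jz (x + 3) l1" "code_at P l1 (compile l1 c1)"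
    using bs_cond0.prems(3) unfolding eq by (auto simp: code_at_Cons code_at_append l1_def)
  have "step P (pc, m) = (l1, m)"
    using step_at[OF code(1,2)] bs_cond0 by (auto simp: mrel_def)
  moreover obtain t' m' where t: "t' \<le> 7 * t" "run P t' (l1, m) = (l1 + length (compile l1 c1), m')"
    "mrel w m' s1"
    using bs_cond0.IH[OF bs_cond0.prems(1) _ code(3) bs_cond0.prems(4)] bs_cond0.prems(2) by auto
  ultimately have "run P (1 + t') (pc, m) = (pc + length (compile pc (Cond x c1 c2)), m')"
    unfolding eq run_add run_1 by (simp add: l1_def)
  then show ?case using t by (intro exI[of _ "1 + t'"] exI[of _ m']) auto
next
  case (bs_cond1 s x c2 t s1 c1)
  define p2 where "p2 = compile (pc + 1) c2"
  define l1 where "l1 = pc + 1 + length p2 + 1"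
  have eq: "compile pc (Cond x c1 c2) = Jz (x + 3) l1 # p2 @ Jmp (l1 + length (compile l1 c1)) # compile l1 c1"
    by (simp add: Let_def p2_def l1_def)
  have code: "pc < length P" "P ! pc = Jz (x + 3) l1" "code_at P (pc + 1) p2"
    "pc + 1 + length p2 < length P" "P ! (pc + 1 + length p2) = Jmp (l1 + length (compile l1 c1))"
    using bs_cond1.prems(3) unfolding eq by (auto simp: code_at_Cons code_at_append l1_def)
  have "step P (pc, m) = (pc + 1, m)"
    using step_at[OF code(1,2)] bs_cond1 by (auto simp: mrel_def)
  moreover obtain t' m' where t: "t' \<le> 7 * t" "run P t' (pc + 1, m) = (pc + 1 + length p2, m')"
    "mrel w m' s1"
    using bs_cond1.IH[OF bs_cond1.prems(1) _ code(3)[unfolded p2_def] bs_cond1.prems(4)] bs_cond1.prems(2)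
    by (auto simp: p2_def)
  moreover have "step P (pc + 1 + length p2, m') = (l1 + length (compile l1 c1), m')"
    using step_at[OF code(4,5)] by simp
  ultimately have "run P (1 + t' + 1) (pc, m) = (pc + length (compile pc (Cond x c1 c2)), m')"
    unfolding eq run_add run_1 by (simp add: l1_def)
  then show ?case using t by (intro exI[of _ "1 + t' + 1"] exI[of _ m']) auto
next
  case (bs_loop0 s x c)
  define p where "p = compile (pc + 1) c"
  have eq: "compile pc (Loop x c) = Jz (x + 3) (pc + length p + 2) # p @ [Jmp pc]"
    by (simp add: Let_def p_def)
  have code: "pc < length P" "P ! pc = Jz (x + 3) (pc + length p + 2)"
    using bs_loop0.prems(3) unfolding eq by (auto simp: code_at_Cons)
  have "run P 1 (pc, m) = (pc + length (compile pc (Loop x c)), m)"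
    unfolding eq run_1 using step_at[OF code] bs_loop0 by (auto simp: mrel_def)
  then show ?case using bs_loop0 by (intro exI[of _ 1] exI[of _ m]) auto
next
  case (bs_loop1 s x c t1 s1 t2 s2)
  define p where "p = compile (pc + 1) c"
  have eq: "compile pc (Loop x c) = Jz (x + 3) (pc + length p + 2) # p @ [Jmp pc]"
    by (simp add: Let_def p_def)
  have code: "pc < length P" "P ! pc = Jz (x + 3) (pc + length p + 2)" "code_at P (pc + 1) p"
    "pc + 1 + length p < length P" "P ! (pc + 1 + length p) = Jmp pc"
    using bs_loop1.prems(3) unfolding eq by (auto simp: code_at_Cons code_at_append)
  have "step P (pc, m) = (pc + 1, m)"
    using step_at[OF code(1,2)] bs_loop1 by (auto simp: mrel_def)
  moreover obtain t1' m1 where 1: "t1' \<le> 7 * t1" "run P t1' (pc + 1, m) = (pc + 1 + length p, m1)"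
    "mrel w m1 s1"
    using bs_loop1.IH(1)[OF bs_loop1.prems(1) _ code(3)[unfolded p_def] bs_loop1.prems(4)] bs_loop1.prems(2)
    by (auto simp: p_def)
  moreover have "step P (pc + 1 + length p, m1) = (pc, m1)"
    using step_at[OF code(4,5)] by simp
  moreover obtain t2' m2 where 2: "t2' \<le> 7 * t2"
    "run P t2' (pc, m1) = (pc + length (compile pc (Loop x c)), m2)" "mrel w m2 s2"
    using bs_loop1.IH(2)[OF bs_loop1.prems(1-3) 1(3)] by blast
  ultimately have "run P (1 + t1' + 1 + t2') (pc, m) = (pc + length (compile pc (Loop x c)), m2)"
    unfolding run_add run_1 by simp
  then show ?case using 1 2 by (intro exI[of _ "1 + t1' + 1 + t2'"] exI[of _ m2]) auto
qed

text \<open>Five doublings turn the input length into an address beyond the input and, as the input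
  is nonempty, beyond cell 30. The first symbol is stored there, which frees cell 1 for the constant
  1; each further symbol goes one cell higher. With 29 further symbols cell 0 ends at 32 times the
  length plus 29, which is \<open>base w\<close>.\<close>

fun save_code :: "nat \<Rightarrow> instr list" where
  "save_code 0 = replicate 5 (Add 0 0 0) @ [Store 0 1, Const 1 1]"
| "save_code (Suc n) = save_code n @ [Add 0 0 1, Store 0 (n + 2)]"

lemma mexec_save_code:
  assumes w: "1 \<le> length w" and m0: "m0 = snd (init_conf w)"
  shows "n \<le> 29 \<Longrightarrow> mexec (save_code n) m0 0 = 32 * length w + n
    \<and> mexec (save_code n) m0 1 = 1
    \<and> (\<forall>i\<le>n. mexec (save_code n) m0 (32 * length w + i) = m0 (Suc i))
    \<and> (\<forall>i. 2 \<le> i \<and> i < 32 * length w \<longrightarrow> mexec (save_code n) m0 i = m0 i)"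
proof (induction n)
  case 0
  have "m0 0 = length w" "w \<noteq> []" using w by (auto simp: m0 init_conf_def)
  then show ?case using w by (simp add: numeral_eq_Suc)
next
  case (Suc n)
  let ?m = "mexec (save_code n) m0"
  have IH: "?m 0 = 32 * length w + n" "?m 1 = 1" "\<forall>i\<le>n. ?m (32 * length w + i) = m0 (Suc i)"
    "\<forall>i. 2 \<le> i \<and> i < 32 * length w \<longrightarrow> ?m i = m0 i"
    using Suc by auto
  \<comment> \<open>The cell being copied lies below the block of saved symbols, so earlier stores
    have not changed it.\<close>
  have "mexec (save_code (Suc n)) m0 =
    ?m(0 := 32 * length w + Suc n, 32 * length w + Suc n := m0 (Suc (Suc n)))"
    using IH(1,2,4) w Suc.prems by (simp add: mexec_append)
  then show ?case using IH w by (auto simp: le_Suc_eq)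
qed

lemma length_save_code: "length (save_code n) = 7 + 2 * n"
  by (induction n) auto

lemma straight_save_code: "i \<in> set (save_code n) \<Longrightarrow> straight i"
  by (induction n) (auto simp: straight_def)

text \<open>65 is the length of \<open>save_code 29\<close>. Cell 0 can receive the answer because
  the base address is no longer used at that point.\<close>

definition assemble :: "nat \<Rightarrow> com \<Rightarrow> instr list" where
  "assemble x c = (let p = compile 65 c in
     save_code 29 @ p @ [Const 0 0, Jz (x + 3) (65 + length p + 3), Const 0 1])"

theorem assemble_decides:
  assumes w: "1 \<le> length w" and c: "com_wf c" and x: "x < 28"
    and wp: "\<And>s. wp w c s T (\<lambda>s'. (fst s' x \<noteq> 0) = b)"
  shows "ram_decides_within (assemble x c) w b (7 * T + 68)"
proof -
  let ?P = "assemble x c"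
  define p where "p = compile 65 c"
  define m0 where "m0 = snd (init_conf w)"
  define m where "m = mexec (save_code 29) m0"
  \<comment> \<open>The registers start with leftovers of the input, which is why the premise on
    \<open>c\<close> covers every store.\<close>
  define s :: store where "s = (\<lambda>i. m (i + 3), \<lambda>j i. m (base w + 1 + j + 8 * i))"
  note save = mexec_save_code[OF w m0_def, of 29, folded m_def]
  have len: "length (save_code 29) = 65" by (simp add: length_save_code)
  have eq: "?P = save_code 29 @ p @ [Const 0 0, Jz (x + 3) (65 + length p + 3), Const 0 1]"
    by (simp add: assemble_def p_def Let_def)
  have code: "code_at ?P 0 (save_code 29)" "code_at ?P 65 p"
    "code_at ?P (65 + length p) [Const 0 0, Jz (x + 3) (65 + length p + 3), Const 0 1]"
    using len code_at_mid[of "[]" 0 "save_code 29"] code_at_mid[of "save_code 29" 65 p]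
      code_at_mid[of "save_code 29 @ p" _ _ "[]"] unfolding eq by simp_all
  have len_P: "length ?P = 65 + length p + 3" using len unfolding eq by simp
  have in0: "m0 i = w ! (i - 1)" if "1 \<le> i" "i \<le> length w" for i
    using that by (simp add: m0_def init_conf_def)
  have m_rel: "mrel w m s"
    unfolding mrel_def
  proof (intro conjI allI impI)
    show "m 0 = base w" using save by (simp add: base_def)
  next
    fix i assume i: "1 \<le> i \<and> i \<le> length w \<and> i \<le> 30"
    then have "base w - 30 + i = 32 * length w + (i - 1)" "i - 1 \<le> 29" by (auto simp: base_def)
    then have "m (base w - 30 + i) = m0 (Suc (i - 1))" using save by simp
    then show "m (base w - 30 + i) = w ! (i - 1)" using i in0 by simp
  next
    fix i assume i: "30 < i \<and> i \<le> length w"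
    then show "m i = w ! (i - 1)" using save in0 by auto
  qed (auto simp: s_def)
  have r1: "run ?P 65 (init_conf w) = (65, m)"
    using run_straight[OF code(1), of m0] straight_save_code len
    by (simp add: m_def m0_def init_conf_def)
  obtain t s' where t: "bs w c s t s'" "t \<le> T" "(fst s' x \<noteq> 0) = b"
    using wp[of s] by (auto simp: wp_def)
  obtain t' m' where t': "t' \<le> 7 * t" "run ?P t' (65, m) = (65 + length p, m')" "mrel w m' s'"
    using compile_sim[OF t(1) w c code(2)[unfolded p_def] m_rel] unfolding p_def by auto
  let ?pc = "65 + length p"
  have m'x: "m' (x + 3) = fst s' x" using t' x by (simp add: mrel_def)
  have st: "step ?P (?pc, m') = (?pc + 1, m'(0 := 0))"
    "step ?P (?pc + 1, m'(0 := 0)) = (if fst s' x = 0 then ?pc + 3 else ?pc + 2, m'(0 := 0))"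
    "step ?P (?pc + 2, m'(0 := 0)) = (?pc + 3, m'(0 := 1))"
    using code(3) m'x
    by (auto simp: code_at_Cons step_at add.assoc)
  have halt: "halted ?P (?pc + 3, m'')" "step ?P (?pc + 3, m'') = (?pc + 3, m'')" for m''
    using len_P by (auto simp: halted_def step_def)
  \<comment> \<open>For a negative answer the machine has halted one step earlier, and the last step
    leaves the configuration as it is.\<close>
  have "run ?P (65 + t' + 1 + 1 + 1) (init_conf w) = (?pc + 3, m'(0 := if fst s' x = 0 then 0 else 1))"
    unfolding run_add run_1 r1 t'(2) st
    using st(3) halt(2)[of "m'(0 := 0)"] by simp
  then show ?thesis
    unfolding ram_decides_within_def using halt t t'
    by (intro exI[of _ "65 + t' + 1 + 1 + 1"]) auto
qed

lemma ram_decides_within_mono: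
  "ram_decides_within P w b T \<Longrightarrow> T \<le> T' \<Longrightarrow> ram_decides_within P w b T'"
  unfolding ram_decides_within_def by (meson le_trans)

section \<open>Evaluating the right formula on the tree\<close>

text \<open>Registers: 0 and 9 hold the constants 1 and 0, 1 the number of nodes, 2 that of variable occurrences,
  3 the token pointer, 4 the number of tokens left, 5 the stack pointer, 6 and 7 tag and argument of the
  current token, 8 the answer, 21 the read position; the others are scratch. Arrays: 0 parents, 1 edge
  labels, 2 and 3 nodes and names of variable occurrences, 4 node stack of the parser, 5 and 6 tags and
  arguments of the tokens, 7 the stack of sets, one row of truth values (nonzero for true) per set.\<close>

abbreviation skip :: com where "skip \<equiv> Op (AConst 27 0)"

definition fill_body :: com where
  "fill_body = Op (APut 7 10 13) ;; Op (AAdd 10 10 0) ;; Op (ASub 12 12 0)"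

text \<open>Run for every token: the row above the stack may hold remains of popped sets. For
  \<open>Top\<close> the filled row is already the result; otherwise it is a blank work
  area.\<close>

definition fill_code :: com where
  "fill_code = (Cond 6 (Op (AConst 13 1)) (Op (AConst 13 0)) ;; Op (AAdd 10 5 9) ;; Op (AAdd 12 1 9)) ;;
     Loop 12 fill_body"

text \<open>The two truncated subtractions add up to the distance of the two names, which is 0
  exactly if they agree.\<close>

definition var_body :: com where
  "var_body = Op (ASub 12 12 0) ;; Op (AGet 10 3 12) ;; Op (ASub 11 10 7) ;; Op (ASub 10 7 10) ;;
     Op (AAdd 10 10 11) ;; Cond 10 (Op (AGet 10 2 12) ;; Op (AAdd 10 10 5) ;; Op (APut 7 10 0)) skip"

definition var_code :: com where
  "var_code = Op (AAdd 12 2 9) ;; Loop 12 var_body ;; Op (AAdd 5 5 1)"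

definition and_body :: com where
  "and_body = Op (AGet 10 7 19) ;; Cond 10 (Op (APut 7 11 10)) skip ;; Op (AAdd 19 19 0) ;;
     Op (AAdd 11 11 0) ;; Op (ASub 12 12 0)"

definition and_code :: com where
  "and_code = (Op (ASub 19 5 1) ;; Op (ASub 11 19 1) ;; Op (AAdd 12 1 9)) ;; Loop 12 and_body ;;
     Op (ASub 5 5 1)"

text \<open>Register 16 becomes nonzero if the edge label differs from the argument, register 15 if
  it exceeds it. The tests for 0 are needed since \<omega> is coded as 0, below all the other
  codes.\<close>

definition cmp_code :: com where
  "cmp_code = Op (ASub 16 13 7) ;; Op (ASub 10 7 13) ;; Op (AAdd 16 16 10) ;;
     Cond 7 (Op (AConst 15 0)) (Cond 13 (Op (AConst 15 1)) (Op (ASub 15 13 7)))"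

text \<open>Row 19 holds the given set and is turned into the nodes that reach it along edges labelled at least
  the argument; the free row 5 collects the nodes that reach it as in \<open>down\<close>.\<close>
definition up_body :: "bool \<Rightarrow> com" where
  "up_body c = Op (AGet 13 1 12) ;; Op (AGet 14 0 12) ;; cmp_code ;;
     Op (AAdd 10 19 12) ;; Op (AGet 17 7 10) ;; Op (AAdd 10 5 12) ;; Op (AGet 18 7 10) ;;
     Cond 16 (Op (AAdd 18 17 9))
       (Cond 15 (Op (AConst 17 0) ;; Op (AConst 18 0)) (if c then Op (AAdd 18 17 9) else skip)) ;;
     Cond 17 skip (Op (AAdd 10 19 14) ;; Op (APut 7 10 0)) ;;
     Cond 18 skip (Op (AAdd 10 5 14) ;; Op (APut 7 10 0)) ;;
     Op (ASub 12 12 0)"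

text \<open>Nodes are visited in increasing order, so the parent's entry in the upper row already
  belongs to the parent's representative and one lookup replaces the whole climb. The values are
  copied over the row of the argument.\<close>

definition spread_body :: com where
  "spread_body = Op (AGet 13 1 20) ;; cmp_code ;;
     Cond 15 skip (Op (AGet 14 0 20) ;; Op (AAdd 14 14 5) ;; Op (AGet 14 7 14) ;; Op (APut 7 11 14)) ;;
     Op (AGet 14 7 11) ;; Op (APut 7 19 14) ;;
     Op (AAdd 11 11 0) ;; Op (AAdd 19 19 0) ;; Op (AAdd 20 20 0) ;; Op (ASub 12 12 0)"

definition dia_code :: "bool \<Rightarrow> com" where
  "dia_code c = (Op (ASub 19 5 1) ;; Op (ASub 12 1 0)) ;; Loop 12 (up_body c) ;;
     (Op (AAdd 11 5 9) ;; Op (AAdd 12 1 9) ;; Op (AConst 20 0)) ;; Loop 12 spread_body"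

section \<open>Correctness of the operations on rows\<close>

definition keep :: "mem \<Rightarrow> mem \<Rightarrow> bool" where
  "keep r r' \<longleftrightarrow> (\<forall>q<10. r' q = r q)"

lemma keepD: "keep r r' \<Longrightarrow> q < 10 \<Longrightarrow> r' q = r q"
  by (simp add: keep_def)

lemma keep_upd: "keep r r' \<Longrightarrow> 10 \<le> q \<Longrightarrow> keep r (r'(q := x))"
  by (simp add: keep_def)

lemma keep_refl: "keep r r"
  by (simp add: keep_def)

definition frame_rep :: "frame \<Rightarrow> mem \<Rightarrow> (nat \<Rightarrow> mem) \<Rightarrow> bool" where
  "frame_rep F r a \<longleftrightarrow> r 1 = cnt F \<and> r 2 = length (occ F)
     \<and> (\<forall>i<cnt F. (0 < i \<longrightarrow> a 0 i = par F i) \<and> a 1 i = enc_mod (lab F i))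
     \<and> (\<forall>i<length (occ F). a 2 i = fst (occ F ! i) \<and> a 3 i = snd (occ F ! i))"

text \<open>The head of the list is the top of the stack and occupies the highest row.\<close>

fun bits_rep :: "mem \<Rightarrow> nat \<Rightarrow> nat set list \<Rightarrow> bool" where
  "bits_rep b k [] = True"
| "bits_rep b k (S # L) = ((\<forall>i<k. (b (length L * k + i) \<noteq> 0) = (i \<in> S)) \<and> bits_rep b k L)"

lemma bits_rep_cong:
  "(\<And>i. i < length L * k \<Longrightarrow> b' i = b i) \<Longrightarrow> bits_rep b' k L = bits_rep b k L"
  by (induction L) auto

lemma fill_correct:
  assumes r: "r 0 = 1" "r 9 = 0"
  shows "wp w fill_code (r, a) (6 + 4 * r 1)
    (\<lambda>(r', a'). keep r r' \<and> (\<forall>j. j \<noteq> 7 \<longrightarrow> a' j = a j)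
      \<and> (\<forall>i. a' 7 i = (if r 5 \<le> i \<and> i < r 5 + r 1 then (if r 6 = 0 then 1 else 0) else a 7 i)))"
proof -
  define f :: nat where "f = (if r 6 = 0 then 1 else 0)"
  define I where "I = (\<lambda>n (r' :: mem) a'. keep r r' \<and> r' 13 = f \<and> r' 12 = n \<and> n \<le> r 1 \<and> r' 10 = r 5 + (r 1 - n)
    \<and> (\<forall>j. j \<noteq> 7 \<longrightarrow> a' j = a j)
    \<and> (\<forall>i. a' 7 i = (if r 5 \<le> i \<and> i < r 5 + (r 1 - n) then f else a 7 i)))"
  show ?thesis
    unfolding fill_code_def
  proof (rule wp_seqI[OF wp_vc])
    show "vc w (Cond 6 (Op (AConst 13 1)) (Op (AConst 13 0)) ;; Op (AAdd 10 5 9) ;; Op (AAdd 12 1 9))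
      (\<lambda>(r1, a1). I (r 1) r1 a1) (r, a)"
      using r by (auto simp: I_def f_def intro!: keep_upd keep_refl)
  next
    fix r1 a1 assume "(\<lambda>(r1, a1). I (r 1) r1 a1) (r1, a1)"
    then have I: "I (r 1) r1 a1" by simp
    have "wp w (Loop 12 fill_body) (r1, a1) (r 1 * 4 + 1) (\<lambda>(r', a'). I 0 r' a')"
    proof (rule wp_loopI[where I = I, OF _ _ I])
      fix n r' a' assume i: "I (Suc n) r' a'"
      then have "r' 0 = 1" using r by (auto simp: I_def keepD)
      then show "r' 12 \<noteq> 0 \<and> vc w fill_body (\<lambda>(r', a'). I n r' a') (r', a')"
        using i by (auto simp: fill_body_def I_def keep_upd)
    qed (auto simp: I_def fill_body_def)
    then show "wp w (Loop 12 fill_body) (r1, a1) (r 1 * 4 + 1)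
      (\<lambda>(r', a'). keep r r' \<and> (\<forall>j. j \<noteq> 7 \<longrightarrow> a' j = a j)
        \<and> (\<forall>i. a' 7 i = (if r 5 \<le> i \<and> i < r 5 + r 1 then (if r 6 = 0 then 1 else 0) else a 7 i)))"
      by (rule wp_mono) (auto simp: I_def f_def)
  qed auto
qed

definition pushed :: "mem \<Rightarrow> (nat \<Rightarrow> mem) \<Rightarrow> nat \<Rightarrow> nat set list \<Rightarrow> store \<Rightarrow> bool" where
  "pushed r a k L s \<longleftrightarrow> (\<forall>q<10. q \<noteq> 5 \<longrightarrow> fst s q = r q) \<and> (\<forall>j. j \<noteq> 7 \<longrightarrow> snd s j = a j)
     \<and> fst s 5 = length L * k \<and> bits_rep (snd s 7) k L"

lemma var_correct:
  assumes r: "r 0 = 1" "r 9 = 0" and F: "frame_rep F r a" and wf: "wf_frame F"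
    and bits: "bits_rep (a 7) (cnt F) L" and sp: "r 5 = length L * cnt F"
    and blank: "\<forall>x<cnt F. a 7 (r 5 + x) = 0"
  shows "wp w var_code (r, a) (11 * length (occ F) + 3)
    (pushed r a (cnt F) ({x. (x, r 7) \<in> set (occ F)} # L))"
proof -
  have k: "r 1 = cnt F" "r 2 = length (occ F)" using F by (simp_all add: frame_rep_def)
  define I where "I = (\<lambda>n (r' :: mem) a'. keep r r' \<and> r' 12 = n \<and> n \<le> length (occ F)
    \<and> (\<forall>j. j \<noteq> 7 \<longrightarrow> a' j = a j) \<and> (\<forall>i<r 5. a' 7 i = a 7 i)
    \<and> (\<forall>x<cnt F. (a' 7 (r 5 + x) \<noteq> 0) = (\<exists>j. n \<le> j \<and> j < length (occ F) \<and> occ F ! j = (x, r 7))))"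
  have step: "r' 12 \<noteq> 0 \<and> vc w var_body (\<lambda>(r', a'). I n r' a') (r', a')" if "I (Suc n) r' a'" for n r' a'
  proof -
    have i: "keep r r'" "r' 12 = Suc n" "Suc n \<le> length (occ F)" "\<And>j. j \<noteq> 7 \<Longrightarrow> a' j = a j"
      "\<And>i. i < r 5 \<Longrightarrow> a' 7 i = a 7 i"
      "\<And>x. x < cnt F \<Longrightarrow> (a' 7 (r 5 + x) \<noteq> 0) = (\<exists>j. Suc n \<le> j \<and> j < length (occ F) \<and> occ F ! j = (x, r 7))"
      using that unfolding I_def by auto
    have k: "r' 0 = 1" "r' 5 = r 5" "r' 7 = r 7" using i(1) r by (simp_all add: keepD)
    obtain y p where yp: "occ F ! n = (y, p)" by (cases "occ F ! n")
    have y: "a 2 n = y" "a 3 n = p" "y < cnt F"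
      using F i(3) yp wf nth_mem[of n "occ F"] by (auto simp: frame_rep_def wf_frame_def)
    have "n \<le> j \<longleftrightarrow> j = n \<or> Suc n \<le> j" for j by auto
    then have ex: "(\<exists>j. n \<le> j \<and> j < length (occ F) \<and> occ F ! j = (x, r 7)) \<longleftrightarrow>
      (y = x \<and> p = r 7) \<or> (\<exists>j. Suc n \<le> j \<and> j < length (occ F) \<and> occ F ! j = (x, r 7))" for x
      using i(3) yp by auto
    show ?thesis
    proof (cases "p = r 7")
      case True
      then show ?thesis
        using i k y by (auto simp: var_body_def I_def keep_upd ex)
    next
      case False
      then have "r 7 - p + (p - r 7) \<noteq> 0" by auto
      then show ?thesis
        using i k y False by (auto simp: var_body_def I_def keep_upd ex)
    qed
  qed
  show ?thesis
    unfolding var_code_def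
  proof (rule wp_seqI[OF wp_vc])
    show "vc w (Op (AAdd 12 2 9)) (\<lambda>(r1, a1). I (length (occ F)) r1 a1) (r, a)"
      using r k blank by (auto simp: I_def intro!: keep_upd keep_refl)
  next
    fix r1 a1 assume "(\<lambda>(r1, a1). I (length (occ F)) r1 a1) (r1, a1)"
    then have I: "I (length (occ F)) r1 a1" by simp
    show "wp w (Loop 12 var_body ;; Op (AAdd 5 5 1)) (r1, a1) (length (occ F) * 11 + 2)
      (pushed r a (cnt F) ({x. (x, r 7) \<in> set (occ F)} # L))"
    proof (rule wp_seqI[OF wp_loopI[where I = I, OF step _ I]])
      fix r' a' assume "(\<lambda>(r', a'). I 0 r' a') (r', a')"
      then have s: "keep r r'" "\<forall>j. j \<noteq> 7 \<longrightarrow> a' j = a j" "\<forall>i<r 5. a' 7 i = a 7 i"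
        "\<forall>x<cnt F. (a' 7 (r 5 + x) \<noteq> 0) = (\<exists>j. j < length (occ F) \<and> occ F ! j = (x, r 7))"
        by (auto simp: I_def)
      have "bits_rep (a' 7) (cnt F) ({x. (x, r 7) \<in> set (occ F)} # L)"
        using s sp bits by (auto simp: in_set_conv_nth cong: bits_rep_cong)
      then show "wp w (Op (AAdd 5 5 1)) (r', a') 1 (pushed r a (cnt F) ({x. (x, r 7) \<in> set (occ F)} # L))"
        using s k sp by (intro wp_vc) (auto simp: keepD pushed_def)
    qed (auto simp: I_def var_body_def)
  qed auto
qed

lemma and_correct:
  assumes r: "r 0 = 1" "r 9 = 0" "r 1 = k"
    and bits: "bits_rep (a 7) k (S1 # S2 # L)" and sp: "r 5 = length (S1 # S2 # L) * k"
  shows "wp w and_code (r, a) (8 * k + 5) (pushed r a k ((S1 \<inter> S2) # L))"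
proof -
  define b where "b = length L * k"
  \<comment> \<open>The upper row is never written, so its bit for position \<open>i\<close> can be
    read at \<open>i + k\<close> in the original array.\<close>
  define I where "I = (\<lambda>n (r' :: mem) a'. keep r r' \<and> r' 12 = n \<and> n \<le> k
    \<and> r' 11 = b + (k - n) \<and> r' 19 = b + k + (k - n)
    \<and> (\<forall>j. j \<noteq> 7 \<longrightarrow> a' j = a j)
    \<and> (\<forall>i. a' 7 i = (if b \<le> i \<and> i < b + (k - n) \<and> a 7 (i + k) = 0 then 0 else a 7 i)))"
  have step: "r' 12 \<noteq> 0 \<and> vc w and_body (\<lambda>(r', a'). I n r' a') (r', a')" if "I (Suc n) r' a'" for n r' a'
  proof -
    define d where "d = k - Suc n"
    have i: "keep r r'" "r' 12 = Suc n" "Suc n \<le> k" "r' 11 = b + d" "r' 19 = b + k + d"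
      "\<And>j. j \<noteq> 7 \<Longrightarrow> a' j = a j"
      "\<And>i. a' 7 i = (if b \<le> i \<and> i < b + d \<and> a 7 (i + k) = 0 then 0 else a 7 i)"
      using that unfolding I_def d_def by auto
    have d: "k - n = Suc d" "d < k" using i(3) by (auto simp: d_def)
    have r0: "r' 0 = 1" using i(1) r by (simp add: keepD)
    have top: "a' 7 (b + k + d) = a 7 (b + d + k)" using i(7) d by (simp add: ac_simps)
    show ?thesis
      using i(1-6) r0 top d
      by (cases "a 7 (b + d + k) = 0") (auto simp: and_body_def I_def keep_upd i(7) less_Suc_eq)
  qed
  show ?thesis
    unfolding and_code_def
  proof (rule wp_seqI[OF wp_vc])
    show "vc w (Op (ASub 19 5 1) ;; Op (ASub 11 19 1) ;; Op (AAdd 12 1 9)) (\<lambda>(r1, a1). I k r1 a1) (r, a)"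
      using r sp by (auto simp: I_def b_def intro!: keep_upd keep_refl)
  next
    fix r1 a1 assume "(\<lambda>(r1, a1). I k r1 a1) (r1, a1)"
    then have I: "I k r1 a1" by simp
    show "wp w (Loop 12 and_body ;; Op (ASub 5 5 1)) (r1, a1) (8 * k + 2) (pushed r a k ((S1 \<inter> S2) # L))"
    proof (rule wp_seqI[OF wp_loopI[where I = I, OF step _ I]])
      fix r' a' assume "(\<lambda>(r', a'). I 0 r' a') (r', a')"
      then have s: "keep r r'" "\<forall>j. j \<noteq> 7 \<longrightarrow> a' j = a j"
        "\<And>i. a' 7 i = (if b \<le> i \<and> i < b + k \<and> a 7 (i + k) = 0 then 0 else a 7 i)"
        by (auto simp: I_def)
      have "bits_rep (a' 7) k L = bits_rep (a 7) k L"
        by (rule bits_rep_cong) (simp add: s(3) b_def)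
      moreover have "(a' 7 (b + i) \<noteq> 0) = (i \<in> S1 \<inter> S2)" if "i < k" for i
      proof -
        have "(a 7 (b + i + k) \<noteq> 0) = (i \<in> S1)" "(a 7 (b + i) \<noteq> 0) = (i \<in> S2)"
          using bits that by (auto simp: b_def ac_simps)
        then show ?thesis using that by (auto simp: s(3))
      qed
      ultimately have "bits_rep (a' 7) k ((S1 \<inter> S2) # L)" using bits by (simp add: b_def)
      then show "wp w (Op (ASub 5 5 1)) (r', a') 1 (pushed r a k ((S1 \<inter> S2) # L))"
        using s(1,2) r sp by (intro wp_vc) (auto simp: keepD pushed_def)
    qed (auto simp: I_def and_body_def)
  qed auto
qed

definition gt_val :: "nat \<Rightarrow> nat \<Rightarrow> nat" where
  "gt_val g b = (if b = 0 then 0 else if g = 0 then 1 else g - b)"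

lemma gt_val_enc: "gt_val (enc_mod x) (enc_mod y) \<noteq> 0 \<longleftrightarrow> y < x"
  by (cases x; cases y) (auto simp: gt_val_def)

definition neq_val :: "nat \<Rightarrow> nat \<Rightarrow> nat" where
  "neq_val g b = g - b + (b - g)"

lemma neq_val_enc: "neq_val (enc_mod x) (enc_mod y) = 0 \<longleftrightarrow> x = y"
  by (cases x; cases y) (auto simp: neq_val_def)

lemma vc_cmp:
  "vc w cmp_code Q (r, a) = Q (r(16 := neq_val (r 13) (r 7), 10 := r 7 - r 13, 15 := gt_val (r 13) (r 7)), a)"
proof -
  have "r(16 := u, 10 := v, 16 := u') = r(16 := u', 10 := v)" for u v u'
    by auto
  then show ?thesis by (auto simp: cmp_code_def gt_val_def neq_val_def)
qed

lemma cost_cmp: "cost cmp_code = 8"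
  by (simp add: cmp_code_def)

definition ge_some :: "frame \<Rightarrow> enat \<Rightarrow> nat set \<Rightarrow> nat \<Rightarrow> bool" where
  "ge_some F b S u \<longleftrightarrow> (\<exists>z\<in>S. ge_path F b u z)"

definition down_some :: "bool \<Rightarrow> frame \<Rightarrow> enat \<Rightarrow> nat set \<Rightarrow> nat \<Rightarrow> bool" where
  "down_some c F b S u \<longleftrightarrow> (\<exists>z\<in>S. down c F b u z)"

text \<open>Recasts reachability as a recursion over the children of \<open>u\<close>, which is the
  form in which the upward pass computes it.\<close>

lemma ge_some_unfold:
  "u < cnt F \<Longrightarrow> ge_some F b S u \<longleftrightarrow>
    u \<in> S \<or> (\<exists>v. 0 < v \<and> v < cnt F \<and> par F v = u \<and> b \<le> lab F v \<and> ge_some F b S v)"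
proof -
  assume u: "u < cnt F"
  have "ge_path F b u z \<longleftrightarrow> z = u \<or>
      (\<exists>v. 0 < v \<and> v < cnt F \<and> par F v = u \<and> b \<le> lab F v \<and> ge_path F b v z)" for z
    using u by (auto elim: ge_path.cases intro: ge_path.intros)
  then show ?thesis unfolding ge_some_def by metis
qed

lemma down_some_unfold:
  "down_some c F b S u \<longleftrightarrow>
    (\<exists>v. 0 < v \<and> v < cnt F \<and> par F v = u \<and>
      (b \<le> lab F v \<and> (c \<or> lab F v = b) \<and> ge_some F b S v \<or> b < lab F v \<and> down_some c F b S v))"
proof -
  have "down c F b u z \<longleftrightarrow>
    (\<exists>v. 0 < v \<and> v < cnt F \<and> par F v = u \<and>
      (b \<le> lab F v \<and> (c \<or> lab F v = b) \<and> ge_path F b v z \<or> b < lab F v \<and> down c F b v z))" for z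
    by (auto elim: down.cases intro: down.intros)
  then show ?thesis unfolding ge_some_def down_some_def by metis
qed

lemma down_some_ge_some: "down_some c F b S u \<Longrightarrow> ge_some F b S u"
  unfolding ge_some_def down_some_def using down_ge by blast

text \<open>\<open>A\<close> and \<open>B\<close> tell whether the current node passes a bit to its
  parent in row 19 and in row 5. All nine outcomes of the tests are executed here, apart from any
  meaning of the rows.\<close>

lemma vc_up_body:
  assumes r: "r 0 = 1" "r 9 = 0"
    and e: "e = neq_val (a 1 (r 12)) (r 7)" and d: "d = gt_val (a 1 (r 12)) (r 7)" and p: "p = a 0 (r 12)"
    and nv: "nv = a 7 (r 19 + r 12)" and mv: "mv = a 7 (r 5 + r 12)"
    and A: "A \<longleftrightarrow> nv \<noteq> 0 \<and> (e = 0 \<or> d \<noteq> 0)"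
    and B: "B \<longleftrightarrow> (if e = 0 then nv \<noteq> 0 else d \<noteq> 0 \<and> (if c then nv \<noteq> 0 else mv \<noteq> 0))"
    and Q: "\<And>r' a'. keep r r' \<Longrightarrow> r' 19 = r 19 \<Longrightarrow> r' 12 = r 12 - 1 \<Longrightarrow> (\<And>j. j \<noteq> 7 \<Longrightarrow> a' j = a j) \<Longrightarrow>
      (\<And>i. a' 7 i = (if A \<and> i = r 19 + p \<or> B \<and> i = r 5 + p then 1 else a 7 i)) \<Longrightarrow> Q (r', a')"
  shows "vc w (up_body c) Q (r, a)"
proof -
  note defs = up_body_def vc_cmp p[symmetric] nv[symmetric] mv[symmetric] r
    e[symmetric, unfolded One_nat_def] d[symmetric, unfolded One_nat_def]
  consider "e = 0" "nv = 0" | "e = 0" "nv \<noteq> 0" | "e \<noteq> 0" "d = 0" | "e \<noteq> 0" "d \<noteq> 0" "nv = 0" "c"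
    | "e \<noteq> 0" "d \<noteq> 0" "nv \<noteq> 0" "c" | "e \<noteq> 0" "d \<noteq> 0" "nv = 0" "mv = 0" "\<not> c"
    | "e \<noteq> 0" "d \<noteq> 0" "nv = 0" "mv \<noteq> 0" "\<not> c" | "e \<noteq> 0" "d \<noteq> 0" "nv \<noteq> 0" "mv = 0" "\<not> c"
    | "e \<noteq> 0" "d \<noteq> 0" "nv \<noteq> 0" "mv \<noteq> 0" "\<not> c"
    by blast
  then show ?thesis
    by cases (simp add: defs, rule Q, auto simp: keep_upd keep_refl A B)+
qed

lemma up_correct:
  assumes r: "r 0 = 1" "r 9 = 0" and F: "frame_rep F r a" and wf: "wf_frame F"
    and arg: "r 7 = enc_mod b"
    and row: "r 19 + cnt F = r 5" "r 12 = cnt F - 1"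
    and S: "\<forall>u<cnt F. (a 7 (r 19 + u) \<noteq> 0) = (u \<in> S)"
    and blank: "\<forall>u<cnt F. a 7 (r 5 + u) = 0"
  shows "wp w (Loop 12 (up_body c)) (r, a) (30 * cnt F)
    (\<lambda>(r', a'). keep r r' \<and> r' 19 = r 19 \<and> (\<forall>j. j \<noteq> 7 \<longrightarrow> a' j = a j) \<and> (\<forall>i<r 19. a' 7 i = a 7 i)
      \<and> (\<forall>u<cnt F. (a' 7 (r 5 + u) \<noteq> 0) = down_some c F b S u))"
proof -
  let ?k = "cnt F"
  \<comment> \<open>The intended contents of the two rows once every node with index above
    \<open>n\<close> has passed its bits to its parent.\<close>
  define N where "N = (\<lambda>n u. u \<in> S \<or> (\<exists>v. n < v \<and> v < ?k \<and> par F v = u \<and> b \<le> lab F v \<and> ge_some F b S v))"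
  define M where "M = (\<lambda>n u. \<exists>v. n < v \<and> v < ?k \<and> par F v = u \<and>
    (b \<le> lab F v \<and> (c \<or> lab F v = b) \<and> ge_some F b S v \<or> b < lab F v \<and> down_some c F b S v))"
  define I where "I = (\<lambda>n (r' :: mem) a'. keep r r' \<and> r' 12 = n \<and> n < ?k \<and> r' 19 = r 19
    \<and> (\<forall>j. j \<noteq> 7 \<longrightarrow> a' j = a j) \<and> (\<forall>i<r 19. a' 7 i = a 7 i)
    \<and> (\<forall>u<?k. (a' 7 (r 19 + u) \<noteq> 0) = N n u) \<and> (\<forall>u<?k. (a' 7 (r 5 + u) \<noteq> 0) = M n u))"
  have parlt: "par F v < v" if "0 < v" "v < ?k" for v using wf_par[OF wf that] .
  \<comment> \<open>All children of \<open>n\<close> have larger indices, so its entries are final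
    when the loop reaches it.\<close>
  have Nn: "N n n = ge_some F b S n" if "n < ?k" for n
    using ge_some_unfold[OF that, of b S] parlt unfolding N_def by (metis gr_implies_not0 not_gr0)
  have Mn: "M n n = down_some c F b S n" for n
    using down_some_unfold[of c F b S n] parlt unfolding M_def by (metis gr_implies_not0 not_gr0)
  have lt: "n < v \<longleftrightarrow> v = Suc n \<or> Suc n < v" for n v :: nat by auto
  have NS: "N n u \<longleftrightarrow> N (Suc n) u \<or> (par F (Suc n) = u \<and> b \<le> lab F (Suc n) \<and> N (Suc n) (Suc n))"
    if "Suc n < ?k" for n u
    unfolding Nn[OF that] unfolding N_def lt[of n] using that by blast
  have MS: "M n u \<longleftrightarrow> M (Suc n) u \<or> (par F (Suc n) = u \<and> (b \<le> lab F (Suc n) \<and> (c \<or> lab F (Suc n) = b) \<and> N (Suc n) (Suc n)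
      \<or> b < lab F (Suc n) \<and> M (Suc n) (Suc n)))"
    if "Suc n < ?k" for n u
    unfolding Nn[OF that] Mn unfolding M_def lt[of n] using that by blast
  \<comment> \<open>On an edge above \<open>b\<close> the program for RC passes on the bit of row 19
    alone; by this inclusion it accounts for the bit of row 5 too.\<close>
  have MN: "M n n \<Longrightarrow> N n n" if "n < ?k" for n
    using Nn[OF that] Mn down_some_ge_some by blast
  have step: "r' 12 \<noteq> 0 \<and> vc w (up_body c) (\<lambda>(r', a'). I n r' a') (r', a')" if "I (Suc n) r' a'" for n r' a'
  proof -
    let ?v = "Suc n"
    have i: "keep r r'" "r' 12 = ?v" "?v < ?k" "r' 19 = r 19" "\<And>j. j \<noteq> 7 \<Longrightarrow> a' j = a j"
      "\<And>i. i < r 19 \<Longrightarrow> a' 7 i = a 7 i"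
      "\<And>u. u < ?k \<Longrightarrow> (a' 7 (r 19 + u) \<noteq> 0) = N ?v u" "\<And>u. u < ?k \<Longrightarrow> (a' 7 (r 5 + u) \<noteq> 0) = M ?v u"
      using that unfolding I_def by auto
    have k: "r' 0 = 1" "r' 5 = r 5" "r' 7 = enc_mod b" "r' 9 = 0" using i(1) r arg by (simp_all add: keepD)
    have g: "a 1 ?v = enc_mod (lab F ?v)" "a 0 ?v = par F ?v" "par F ?v < ?k"
      using F i(3) parlt[of ?v] by (auto simp: frame_rep_def)
    note bits = i(7,8)[OF i(3)]
    define A where "A \<longleftrightarrow> b \<le> lab F ?v \<and> N ?v ?v"
    define B where "B \<longleftrightarrow> b \<le> lab F ?v \<and> (c \<or> lab F ?v = b) \<and> N ?v ?v \<or> b < lab F ?v \<and> M ?v ?v"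
    have a1: "a' 1 = a 1" by (rule i(5)) simp
    have row': "r 5 = r 19 + ?k" using row by simp
    have vc: "vc w (up_body c) (\<lambda>(r', a'). I n r' a') (r', a')"
    proof (rule vc_up_body[where A = A and B = B])
      show "A \<longleftrightarrow> a' 7 (r' 19 + r' 12) \<noteq> 0 \<and>
          (neq_val (a' 1 (r' 12)) (r' 7) = 0 \<or> gt_val (a' 1 (r' 12)) (r' 7) \<noteq> 0)"
        unfolding k i(2,4) a1 g neq_val_enc gt_val_enc bits A_def by auto
      show "B \<longleftrightarrow> (if neq_val (a' 1 (r' 12)) (r' 7) = 0 then a' 7 (r' 19 + r' 12) \<noteq> 0
          else gt_val (a' 1 (r' 12)) (r' 7) \<noteq> 0 \<and>
            (if c then a' 7 (r' 19 + r' 12) \<noteq> 0 else a' 7 (r' 5 + r' 12) \<noteq> 0))"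
        unfolding k i(2,4) a1 g neq_val_enc gt_val_enc bits B_def
        using MN[OF i(3)] by auto
    next
      fix r2 a2
      assume 2: "keep r' r2" "r2 19 = r' 19" "r2 12 = r' 12 - 1" "\<And>j. j \<noteq> 7 \<Longrightarrow> a2 j = a' j"
        "\<And>i. a2 7 i = (if A \<and> i = r' 19 + a' 0 (r' 12) \<or> B \<and> i = r' 5 + a' 0 (r' 12) then 1 else a' 7 i)"
      have p: "a' 0 (r' 12) = par F ?v" using i(5)[of 0] i(2) g by simp
      have "keep r r2" using 2(1) i(1) by (simp add: keep_def)
      moreover have "(a2 7 (r 19 + u) \<noteq> 0) = N n u" if "u < ?k" for u
        unfolding 2(5) p k i(4) NS[OF i(3)] row' using that i(7)[OF that] g(3) by (auto simp: A_def)
      moreover have "(a2 7 (r 5 + u) \<noteq> 0) = M n u" if "u < ?k" for u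
        unfolding 2(5) p k i(4) MS[OF i(3)] using that i(8)[OF that] g(3) unfolding row' by (auto simp: B_def)
      moreover have "a2 7 i = a 7 i" if "i < r 19" for i
        unfolding 2(5) p k i(4) row' using that i(6) by simp
      ultimately show "(\<lambda>(r', a'). I n r' a') (r2, a2)"
        using 2(2-4) i(2-5) by (simp add: I_def)
    qed (use k in auto)
    then show ?thesis using i(2) by simp
  qed
  have "wp w (Loop 12 (up_body c)) (r, a) (30 * ?k) (\<lambda>(r', a'). I 0 r' a')"
  proof (rule wp_loopI[where I = I and n = "?k - 1", OF step])
    have "0 < ?k" using wf by (simp add: wf_frame_def)
    then show "I (?k - 1) r a" using row S blank by (auto simp: I_def N_def M_def keep_refl)
    \<comment> \<open>The body costs 29 and the test 1. The root has no parent, so there are only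
      \<open>?k - 1\<close> rounds.\<close>
    show "(?k - 1) * (cost (up_body c) + 1) + 1 \<le> 30 * ?k" using \<open>0 < ?k\<close>
      by (simp add: up_body_def cost_cmp diff_mult_distrib)
  qed (auto simp: I_def)
  then show ?thesis
  proof (rule wp_mono; clarsimp)
    fix r' a' assume I: "I 0 r' a'"
    have "M 0 u = down_some c F b S u" for u
      unfolding M_def by (subst down_some_unfold) simp
    then show "keep r r' \<and> r' 19 = r 19 \<and> (\<forall>j. j \<noteq> 7 \<longrightarrow> a' j = a j) \<and> (\<forall>i<r 19. a' 7 i = a 7 i)
      \<and> (\<forall>u<cnt F. (0 < a' 7 (r 5 + u)) = down_some c F b S u)"
      using I by (simp add: I_def)
  qed
qed

lemma vc_spread_body:
  assumes r: "r 0 = 1" and d: "d = gt_val (a 1 (r 20)) (r 7)"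
    and x: "x = (if d = 0 then a 7 (r 11) else a 7 (a 0 (r 20) + r 5))"
    and Q: "\<And>r' a'. keep r r' \<Longrightarrow> r' 11 = r 11 + 1 \<Longrightarrow> r' 19 = r 19 + 1 \<Longrightarrow> r' 20 = r 20 + 1 \<Longrightarrow>
      r' 12 = r 12 - 1 \<Longrightarrow> (\<And>j. j \<noteq> 7 \<Longrightarrow> a' j = a j) \<Longrightarrow>
      (\<And>i. a' 7 i = (if i = r 11 \<or> i = r 19 then x else a 7 i)) \<Longrightarrow> Q (r', a')"
  shows "vc w spread_body Q (r, a)"
proof -
  note defs = spread_body_def vc_cmp r d[symmetric, unfolded One_nat_def]
  show ?thesis
    by (cases "d = 0") (simp add: defs, rule Q, auto simp: keep_upd keep_refl x)+
qed

lemma spread_correct: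
  assumes r: "r 0 = 1" and F: "frame_rep F r a" and wf: "wf_frame F"
    and arg: "r 7 = enc_mod b"
    and row: "r 19 + cnt F = r 5" "r 11 = r 5" "r 12 = cnt F" "r 20 = 0"
    and m: "\<forall>u<cnt F. (a 7 (r 5 + u) \<noteq> 0) = m u"
  shows "wp w (Loop 12 spread_body) (r, a) (25 * cnt F + 1)
    (\<lambda>(r', a'). keep r r' \<and> (\<forall>j. j \<noteq> 7 \<longrightarrow> a' j = a j) \<and> (\<forall>i<r 19. a' 7 i = a 7 i)
      \<and> (\<forall>u<cnt F. (a' 7 (r 19 + u) \<noteq> 0) = m (rep F b u)))"
proof -
  let ?k = "cnt F"
  \<comment> \<open>In row 5 the visited entries belong to representatives while the others still
    hold the input \<open>m\<close>.\<close>
  define I where "I = (\<lambda>n (r' :: mem) a'. keep r r' \<and> r' 12 = n \<and> n \<le> ?k \<and> r' 20 = ?k - n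
    \<and> r' 11 = r 5 + (?k - n) \<and> r' 19 = r 19 + (?k - n)
    \<and> (\<forall>j. j \<noteq> 7 \<longrightarrow> a' j = a j) \<and> (\<forall>i<r 19. a' 7 i = a 7 i)
    \<and> (\<forall>u<?k - n. (a' 7 (r 19 + u) \<noteq> 0) = m (rep F b u))
    \<and> (\<forall>u<?k. (a' 7 (r 5 + u) \<noteq> 0) = m (if u < ?k - n then rep F b u else u)))"
  have step: "r' 12 \<noteq> 0 \<and> vc w spread_body (\<lambda>(r', a'). I n r' a') (r', a')" if "I (Suc n) r' a'" for n r' a'
  proof -
    define y where "y = ?k - Suc n"
    have i: "keep r r'" "r' 12 = Suc n" "Suc n \<le> ?k" "r' 20 = y" "r' 11 = r 5 + y" "r' 19 = r 19 + y"
      "\<And>j. j \<noteq> 7 \<Longrightarrow> a' j = a j" "\<And>i. i < r 19 \<Longrightarrow> a' 7 i = a 7 i"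
      "\<And>u. u < y \<Longrightarrow> (a' 7 (r 19 + u) \<noteq> 0) = m (rep F b u)"
      "\<And>u. u < ?k \<Longrightarrow> (a' 7 (r 5 + u) \<noteq> 0) = m (if u < y then rep F b u else u)"
      using that unfolding I_def y_def by auto
    have y: "?k - n = Suc y" "y < ?k" using i(3) by (auto simp: y_def)
    have k: "r' 0 = 1" "r' 5 = r 5" "r' 7 = enc_mod b" using i(1) r arg by (simp_all add: keepD)
    have a1: "a' 1 = a 1" "a' 0 = a 0" by (rule i(7), simp)+
    have g: "a 1 y = enc_mod (lab F y)" using F y by (simp add: frame_rep_def)
    define d where "d = gt_val (a' 1 (r' 20)) (r' 7)"
    define x where "x = (if d = 0 then a' 7 (r' 11) else a' 7 (a' 0 (r' 20) + r' 5))"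
    have d: "d \<noteq> 0 \<longleftrightarrow> b < lab F y" unfolding d_def k i(4) a1 g by (rule gt_val_enc)
    have x: "(x \<noteq> 0) = m (rep F b y)"
    proof (cases "b < lab F y")
      case True
      then have "0 < y" using wf_lab_pos[OF wf] by blast
      then have p: "a 0 y = par F y" "par F y < y" using F wf_par[OF wf] y by (auto simp: frame_rep_def)
      \<comment> \<open>The parent was visited earlier, so its entry already speaks of
        \<open>rep F b (par F y)\<close>.\<close>
      then have "(x \<noteq> 0) = m (rep F b (par F y))"
        using True d i(4) i(10)[of "par F y"] y k a1 unfolding x_def by (simp add: add.commute)
      then show ?thesis using rep_gt[OF wf y(2) True] by simp
    next
      case False
      then show ?thesis using d i(5) i(10)[of y] y unfolding x_def by (simp add: rep_not_gt)
    qed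
    have "vc w spread_body (\<lambda>(r', a'). I n r' a') (r', a')"
    proof (rule vc_spread_body[OF k(1) d_def x_def])
      fix r2 a2
      assume 2: "keep r' r2" "r2 11 = r' 11 + 1" "r2 19 = r' 19 + 1" "r2 20 = r' 20 + 1" "r2 12 = r' 12 - 1"
        "\<And>j. j \<noteq> 7 \<Longrightarrow> a2 j = a' j" "\<And>i. a2 7 i = (if i = r' 11 \<or> i = r' 19 then x else a' 7 i)"
      have row': "r 5 = r 19 + ?k" using row by simp
      have "keep r r2" using 2(1) i(1) by (simp add: keep_def)
      moreover have "(a2 7 (r 19 + u) \<noteq> 0) = m (rep F b u)" if "u < Suc y" for u
        unfolding 2(7) i(5,6) row' using that y i(9)[of u] x by (auto simp: less_Suc_eq)
      moreover have "(a2 7 (r 5 + u) \<noteq> 0) = m (if u < Suc y then rep F b u else u)" if "u < ?k" for u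
        unfolding 2(7) i(5,6) using that y i(10)[of u] x unfolding row' by (auto simp: less_Suc_eq)
      moreover have "a2 7 i = a 7 i" if "i < r 19" for i
        unfolding 2(7) i(5,6) row' using that i(8) by simp
      ultimately show "(\<lambda>(r', a'). I n r' a') (r2, a2)"
        using 2(2-6) i(2-7) y by (simp add: I_def)
    qed
    then show ?thesis using i(2) by simp
  qed
  have "wp w (Loop 12 spread_body) (r, a) (25 * ?k + 1) (\<lambda>(r', a'). I 0 r' a')"
    by (rule wp_loopI[where I = I and n = "?k", OF step])
      (use row m in \<open>auto simp: I_def keep_refl spread_body_def cost_cmp\<close>)
  then show ?thesis by (rule wp_mono) (auto simp: I_def)
qed

lemma dia_correct:
  assumes r: "r 0 = 1" "r 9 = 0" and F: "frame_rep F r a" and wf: "wf_frame F"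
    and arg: "r 7 = enc_mod b"
    and bits: "bits_rep (a 7) (cnt F) (S # L)" and sp: "r 5 = length (S # L) * cnt F"
    and blank: "\<forall>x<cnt F. a 7 (r 5 + x) = 0"
  shows "wp w (dia_code c) (r, a) (55 * cnt F + 6)
    (pushed r a (cnt F) ({x. \<exists>z\<in>S. acc c F b x z} # L))"
proof -
  let ?k = "cnt F" and ?row = "length L * cnt F"
  have k: "r 1 = ?k" "0 < ?k" using F wf by (simp_all add: frame_rep_def wf_frame_def)
  have row: "?row + ?k = r 5" using sp by simp
  have Srow: "\<forall>u<?k. (a 7 (?row + u) \<noteq> 0) = (u \<in> S)" using bits by simp
  have fr: "frame_rep F r' a'" if "keep r r'" "\<forall>j. j \<noteq> 7 \<longrightarrow> a' j = a j" for r' a'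
    using F that by (simp add: frame_rep_def keepD)
  define R1 where "R1 = (\<lambda>(r' :: mem, a'). a' = a \<and> keep r r' \<and> r' 19 = ?row \<and> r' 12 = ?k - 1)"
  define R2 where "R2 = (\<lambda>(r' :: mem, a' :: nat \<Rightarrow> mem). keep r r' \<and> r' 19 = ?row \<and> (\<forall>j. j \<noteq> 7 \<longrightarrow> a' j = a j)
    \<and> (\<forall>i<?row. a' 7 i = a 7 i) \<and> (\<forall>u<?k. (a' 7 (r 5 + u) \<noteq> 0) = down_some c F b S u))"
  define R3 where "R3 = (\<lambda>(r', a'). R2 (r', a') \<and> r' 11 = r 5 \<and> r' 12 = ?k \<and> r' 20 = 0)"
  show ?thesis
    unfolding dia_code_def
  proof (rule wp_seqI[OF wp_vc])
    show "vc w (Op (ASub 19 5 1) ;; Op (ASub 12 1 0)) R1 (r, a)"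
      using r k sp by (simp add: R1_def keep_upd keep_refl)
  next
    fix r1 a1 assume "R1 (r1, a1)"
    then have 1: "a1 = a" "keep r r1" "r1 19 = ?row" "r1 12 = ?k - 1" by (auto simp: R1_def)
    then have e1: "r1 0 = 1" "r1 9 = 0" "r1 7 = enc_mod b" "r1 5 = r 5" using r arg by (simp_all add: keepD)
    show "wp w (Loop 12 (up_body c) ;; (Op (AAdd 11 5 9) ;; Op (AAdd 12 1 9) ;; Op (AConst 20 0)) ;; Loop 12 spread_body)
      (r1, a1) (55 * ?k + 4) (pushed r a ?k ({x. \<exists>z\<in>S. acc c F b x z} # L))"
    proof (rule wp_seqI[OF wp_mono[OF up_correct[where F = F and S = S and b = b]]])
      show "frame_rep F r1 a1" using fr 1 by simp
    next
      fix s' assume "case s' of (r', a') \<Rightarrow> keep r1 r' \<and> r' 19 = r1 19 \<and> (\<forall>j. j \<noteq> 7 \<longrightarrow> a' j = a1 j) \<and>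
        (\<forall>i<r1 19. a' 7 i = a1 7 i) \<and> (\<forall>u<?k. (a' 7 (r1 5 + u) \<noteq> 0) = down_some c F b S u)"
      then show "R2 s'" using 1 e1 by (auto simp: R2_def keep_def)
    next
      fix r2 a2 assume R2: "R2 (r2, a2)"
      then have 2: "keep r r2" by (simp add: R2_def)
      show "wp w ((Op (AAdd 11 5 9) ;; Op (AAdd 12 1 9) ;; Op (AConst 20 0)) ;; Loop 12 spread_body)
        (r2, a2) (25 * ?k + 4) (pushed r a ?k ({x. \<exists>z\<in>S. acc c F b x z} # L))"
      proof (rule wp_seqI[OF wp_vc])
        show "vc w (Op (AAdd 11 5 9) ;; Op (AAdd 12 1 9) ;; Op (AConst 20 0)) R3 (r2, a2)"
          using R2 2 r k by (simp add: R3_def R2_def keep_upd keepD)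
      next
        fix r3 a3 assume "R3 (r3, a3)"
        then have 3: "keep r r3" "r3 19 = ?row" "\<forall>j. j \<noteq> 7 \<longrightarrow> a3 j = a j" "\<forall>i<?row. a3 7 i = a 7 i"
          "\<forall>u<?k. (a3 7 (r 5 + u) \<noteq> 0) = down_some c F b S u" "r3 11 = r 5" "r3 12 = ?k" "r3 20 = 0"
          by (auto simp: R3_def R2_def)
        have e3: "r3 0 = 1" "r3 7 = enc_mod b" "r3 5 = r 5" using r arg 3(1) by (simp_all add: keepD)
        show "wp w (Loop 12 spread_body) (r3, a3) (25 * ?k + 1) (pushed r a ?k ({x. \<exists>z\<in>S. acc c F b x z} # L))"
        proof (rule wp_mono[OF spread_correct[where F = F and b = b and m = "down_some c F b S"]])
          show "frame_rep F r3 a3" using fr 3 by simp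
        next
          fix s' assume s': "case s' of (r', a') \<Rightarrow> keep r3 r' \<and> (\<forall>j. j \<noteq> 7 \<longrightarrow> a' j = a3 j) \<and>
            (\<forall>i<r3 19. a' 7 i = a3 7 i) \<and> (\<forall>u<?k. (a' 7 (r3 19 + u) \<noteq> 0) = down_some c F b S (rep F b u))"
          obtain r4 a4 where s4: "s' = (r4, a4)" by (cases s')
          have "bits_rep (a4 7) ?k L = bits_rep (a 7) ?k L"
            by (rule bits_rep_cong) (use s' s4 3 in auto)
          then have "bits_rep (a4 7) ?k ({x. \<exists>z\<in>S. acc c F b x z} # L)"
            using s' s4 3 bits by (simp add: acc_def down_some_def)
          then show "pushed r a ?k ({x. \<exists>z\<in>S. acc c F b x z} # L) s'"
            using s' s4 3 sp by (simp add: pushed_def keep_def)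
        qed (use 3 e3 row wf in auto)
      qed auto
    qed (use 1 e1 row Srow blank wf in auto)
  qed auto
qed

section \<open>Evaluation of token lists\<close>

fun toks :: "fm \<Rightarrow> (nat \<times> nat) list" where
  "toks Top = [(0, 0)]"
| "toks (And A B) = (1, 0) # toks A @ toks B"
| "toks (Dia a A) = (2, enc_mod a) # toks A"
| "toks (Var p) = [(3, p)]"

lemma length_toks: "length (toks A) = flen A"
  by (induction A) auto

lemma flen_pos: "0 < flen A"
  by (induction A) auto

text \<open>Token lists of lists of formulas are closed under suffixes, which those of single
  formulas are not.\<close>

definition forest :: "fm list \<Rightarrow> (nat \<times> nat) list" where
  "forest As = concat (map toks As)"

lemma forest_simps [simp]: "forest [] = []" "forest (A # As) = toks A @ forest As"
  by (simp_all add: forest_def)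

lemma forest_Cons:
  assumes "forest As = t # ts"
  obtains p As' where "t = (3, p)" "ts = forest As'"
  | As' where "t = (0, 0)" "ts = forest As'"
  | A B As' where "t = (1, 0)" "ts = forest (A # B # As')"
  | b A As' where "t = (2, enc_mod b)" "ts = forest (A # As')"
proof -
  obtain A As' where As: "As = A # As'" using assms by (cases As) auto
  show ?thesis
    by (cases A) (use assms that in \<open>auto simp: As\<close>)
qed

lemma forest_suffix: "forest As = us @ ts \<Longrightarrow> \<exists>As'. ts = forest As'"
proof (induction us arbitrary: As)
  case Nil
  then show ?case by auto
next
  case (Cons u us)
  from Cons.prems have "forest As = u # (us @ ts)" by simp
  then have "\<exists>As'. us @ ts = forest As'" by (rule forest_Cons) blast+
  then show ?case using Cons.IH by metis
qed

definition dec_mod :: "nat \<Rightarrow> enat" where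
  "dec_mod n = (if n = 0 then \<infinity> else enat (n - 1))"

lemma dec_enc_mod [simp]: "dec_mod (enc_mod b) = b"
  by (cases b) (auto simp: dec_mod_def)

text \<open>Tokens are read from right to left, so the operands are on the stack before their
  operator, the left conjunct on top.\<close>

fun tok_step :: "bool \<Rightarrow> frame \<Rightarrow> nat \<times> nat \<Rightarrow> nat set list \<Rightarrow> nat set list" where
  "tok_step c F (t, p) L =
    (if t = 0 then UNIV # L
     else if t = 1 then (hd L \<inter> hd (tl L)) # tl (tl L)
     else if t = 2 then {x. \<exists>z\<in>hd L. acc c F (dec_mod p) x z} # tl L
     else {x. (x, p) \<in> set (occ F)} # L)"

lemma foldr_toks: "foldr (tok_step c F) (toks B) L = {x. sat c F x B} # L"
  by (induction B arbitrary: L) auto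

definition eval_body :: "bool \<Rightarrow> com" where
  "eval_body c = (Op (ASub 3 3 0) ;; Op (ASub 4 4 0) ;; Op (AGet 6 5 3) ;; Op (AGet 7 6 3)) ;; fill_code ;;
     Cond 6 (Op (AAdd 5 5 1))
       (Op (ASub 6 6 0) ;; Cond 6 and_code
         (Op (ASub 6 6 0) ;; Cond 6 (dia_code c) var_code))"

definition eval_inv :: "frame \<Rightarrow> mem \<Rightarrow> mem \<Rightarrow> nat \<Rightarrow> nat \<Rightarrow> nat set list \<Rightarrow> mem \<Rightarrow> (nat \<Rightarrow> mem) \<Rightarrow> bool" where
  "eval_inv F tag arg q n L r a \<longleftrightarrow> r 0 = 1 \<and> r 9 = 0 \<and> frame_rep F r a \<and> r 3 = q \<and> r 4 = n
     \<and> r 5 = length L * cnt F \<and> bits_rep (a 7) (cnt F) L \<and> a 5 = tag \<and> a 6 = arg"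

lemma eval_inv_pushed:
  "eval_inv F tag arg q n L r a \<Longrightarrow> pushed r a (cnt F) L' s \<Longrightarrow> case s of (r', a') \<Rightarrow> eval_inv F tag arg q n L' r' a'"
  by (cases s) (simp add: eval_inv_def pushed_def frame_rep_def)

lemma eval_inv_scratch: "eval_inv F tag arg q n L r a \<Longrightarrow> eval_inv F tag arg q n L (r(6 := x)) a"
  by (simp add: eval_inv_def frame_rep_def)

text \<open>The arity assumptions on \<open>L\<close> exclude stack underflow.\<close>

lemma eval_body_correct:
  assumes inv: "eval_inv F tag arg (Suc q) (Suc n) L r a" and wf: "wf_frame F"
    and tag: "tag q = t" "2 \<le> t \<Longrightarrow> arg q = p"
    and ar: "t = 1 \<Longrightarrow> \<exists>S1 S2 L'. L = S1 # S2 # L'" "t = 2 \<Longrightarrow> (\<exists>S L'. L = S # L') \<and> (\<exists>b. p = enc_mod b)"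
  shows "wp w (eval_body c) (r, a) (60 * (cnt F + length (occ F)) + 20)
    (\<lambda>(r', a'). eval_inv F tag arg q n (tok_step c F (t, p) L) r' a')"
proof -
  let ?k = "cnt F" and ?v = "length (occ F)"
  define Q where "Q = (\<lambda>(r', a'). eval_inv F tag arg q n (tok_step c F (t, p) L) r' a')"
  define R1 where "R1 = (\<lambda>(r' :: mem, a' :: nat \<Rightarrow> mem). eval_inv F tag arg q n L r' a' \<and> r' 6 = t \<and> r' 7 = arg q)"
  define blank where "blank = (\<lambda>(r :: mem) (a :: nat \<Rightarrow> mem). \<forall>x<?k. a 7 (r 5 + x) = (if t = 0 then 1 else 0 :: nat))"
  define R2 where "R2 = (\<lambda>(r' :: mem, a'). R1 (r', a') \<and> blank r' a')"
  have "wp w (eval_body c) (r, a) (60 * (?k + ?v) + 20) Q"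
    unfolding eval_body_def
  proof (rule wp_seqI[OF wp_vc])
    show "vc w (Op (ASub 3 3 0) ;; Op (ASub 4 4 0) ;; Op (AGet 6 5 3) ;; Op (AGet 7 6 3)) R1 (r, a)"
      using inv tag by (simp add: R1_def eval_inv_def frame_rep_def)
  next
    fix r1 a1 assume R1: "R1 (r1, a1)"
    then have 1: "r1 0 = 1" "r1 9 = 0" "r1 1 = ?k" "r1 6 = t" "r1 5 = length L * ?k"
      by (simp_all add: R1_def eval_inv_def frame_rep_def)
    show "wp w (fill_code ;; Cond 6 (Op (AAdd 5 5 1))
       (Op (ASub 6 6 0) ;; Cond 6 and_code (Op (ASub 6 6 0) ;; Cond 6 (dia_code c) var_code)))
       (r1, a1) (60 * (?k + ?v) + 16) Q"
    proof (rule wp_seqI[OF wp_mono[OF fill_correct]])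
      fix s' assume s': "case s' of (r', a') \<Rightarrow> keep r1 r' \<and> (\<forall>j. j \<noteq> 7 \<longrightarrow> a' j = a1 j) \<and>
        (\<forall>i. a' 7 i = (if r1 5 \<le> i \<and> i < r1 5 + r1 1 then if r1 6 = 0 then 1 else 0 else a1 7 i))"
      obtain r2 a2 where s2: "s' = (r2, a2)" by (cases s')
      have "bits_rep (a2 7) ?k L = bits_rep (a1 7) ?k L"
        by (rule bits_rep_cong) (use s' s2 1 in auto)
      then show "R2 s'" using s' s2 1 R1
        by (simp add: R2_def R1_def blank_def eval_inv_def frame_rep_def keep_def)
    next
      fix r2 a2 assume R2: "R2 (r2, a2)"
      then have i2: "eval_inv F tag arg q n L r2 a2" "r2 6 = t" "r2 7 = arg q" "blank r2 a2"
        by (simp_all add: R2_def R1_def)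
      have reg: "r 0 = 1" "r 9 = 0" "r 1 = ?k" "frame_rep F r a" "r 5 = length L * ?k" "bits_rep (a 7) ?k L"
        if "eval_inv F tag arg q n L r a" for r a
        using that by (simp_all add: eval_inv_def frame_rep_def)
      show "wp w (Cond 6 (Op (AAdd 5 5 1))
        (Op (ASub 6 6 0) ;; Cond 6 and_code (Op (ASub 6 6 0) ;; Cond 6 (dia_code c) var_code)))
        (r2, a2) (60 * (?k + ?v) + 10 - 4 * ?k) Q"
      proof (rule wp_cond[where T = "60 * (?k + ?v) + 9 - 4 * ?k", OF wp_vc wp_seqI[OF wp_vc]])
        assume "fst (r2, a2) 6 = 0"
        then have "t = 0" using i2 by simp
        then show "vc w (Op (AAdd 5 5 1)) Q (r2, a2)"
          using i2 reg[OF i2(1)] by (simp add: Q_def eval_inv_def blank_def frame_rep_def)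
      next
        assume "fst (r2, a2) 6 \<noteq> 0"
        then have t: "t \<noteq> 0" using i2 by simp
        define R3 where "R3 = (\<lambda>(r' :: mem, a' :: nat \<Rightarrow> mem). eval_inv F tag arg q n L r' a' \<and> r' 6 = t - 1
          \<and> r' 7 = arg q \<and> blank r' a')"
        show "vc w (Op (ASub 6 6 0)) R3 (r2, a2)"
          using i2 reg[OF i2(1)] by (simp add: R3_def eval_inv_scratch blank_def)
        fix r3 a3 assume "R3 (r3, a3)"
        then have i3: "eval_inv F tag arg q n L r3 a3" "r3 6 = t - 1" "r3 7 = arg q" "blank r3 a3"
          by (simp_all add: R3_def)
        show "wp w (Cond 6 and_code (Op (ASub 6 6 0) ;; Cond 6 (dia_code c) var_code)) (r3, a3)
          (60 * (?k + ?v) + 8 - 4 * ?k) Q"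
        proof (rule wp_cond[OF _ wp_seqI[OF wp_vc]])
          assume "fst (r3, a3) 6 = 0"
          then have t1: "t = 1" using i3 t by simp
          then obtain S1 S2 L' where L: "L = S1 # S2 # L'" using ar by blast
          show "wp w and_code (r3, a3) (60 * (?k + ?v) + 7 - 4 * ?k) Q"
            by (rule wp_mono[OF and_correct[of r3 ?k a3 S1 S2 L']])
              (use reg[OF i3(1)] L t1 eval_inv_pushed[OF i3(1)] in \<open>auto simp: Q_def\<close>)
        next
          assume "fst (r3, a3) 6 \<noteq> 0"
          then have t2: "2 \<le> t" using i3 by simp
          define R4 where "R4 = (\<lambda>(r' :: mem, a' :: nat \<Rightarrow> mem). eval_inv F tag arg q n L r' a' \<and> r' 6 = t - 2
            \<and> r' 7 = p \<and> (\<forall>x<?k. a' 7 (r' 5 + x) = 0))"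
          show "vc w (Op (ASub 6 6 0)) R4 (r3, a3)"
            using i3 reg[OF i3(1)] t2 tag by (simp add: R4_def eval_inv_scratch blank_def)
          fix r4 a4 assume "R4 (r4, a4)"
          then have i4: "eval_inv F tag arg q n L r4 a4" "r4 6 = t - 2" "r4 7 = p" "\<forall>x<?k. a4 7 (r4 5 + x) = 0"
            by (simp_all add: R4_def)
          show "wp w (Cond 6 (dia_code c) var_code) (r4, a4) (60 * (?k + ?v) + 6 - 4 * ?k) Q"
          proof (rule wp_cond)
            assume "fst (r4, a4) 6 = 0"
            then have t2: "t = 2" using i4 t2 by simp
            then obtain S L' b where L: "L = S # L'" and b: "p = enc_mod b" using ar by blast
            show "wp w (dia_code c) (r4, a4) (60 * (?k + ?v) + 5 - 4 * ?k) Q"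
              by (rule wp_mono[OF dia_correct[of r4 F a4 b S L']])
                (use reg[OF i4(1)] i4 L b t2 wf eval_inv_pushed[OF i4(1)] in \<open>auto simp: Q_def wf_frame_def\<close>)
          next
            assume "fst (r4, a4) 6 \<noteq> 0"
            then have t3: "2 < t" using i4 by simp
            show "wp w var_code (r4, a4) (60 * (?k + ?v) + 5 - 4 * ?k) Q"
              by (rule wp_mono[OF var_correct[of r4 F a4 L]])
                (use reg[OF i4(1)] i4 t3 wf eval_inv_pushed[OF i4(1)] in \<open>auto simp: Q_def\<close>)
          qed (use wf in \<open>auto simp: wf_frame_def\<close>)
        qed auto
      qed auto
    qed (use 1 in auto)
  qed auto
  then show ?thesis by (simp add: Q_def)
qed

lemma eval_correct:
  assumes inv: "eval_inv F tag arg (j + flen B) (flen B) [] r a" and wf: "wf_frame F"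
    and tag: "\<And>i. i < flen B \<Longrightarrow> tag (j + i) = fst (toks B ! i)
      \<and> (2 \<le> fst (toks B ! i) \<longrightarrow> arg (j + i) = snd (toks B ! i))"
  shows "wp w (Loop 4 (eval_body c)) (r, a) (flen B * (60 * (cnt F + length (occ F)) + 21) + 1)
    (\<lambda>(r', a'). eval_inv F tag arg j 0 [{x. sat c F x B}] r' a')"
proof -
  define I where "I = (\<lambda>n (r, a). n \<le> flen B
    \<and> eval_inv F tag arg (j + n) n (foldr (tok_step c F) (drop n (toks B)) []) r a)"
  have "wp w (Loop 4 (eval_body c)) (r, a) (flen B * (60 * (cnt F + length (occ F)) + 21) + 1) (I 0)"
  proof (rule wp_loop[where I = I])
    fix n s assume "I (Suc n) s"
    then obtain r' a' where s: "s = (r', a')" and n: "n < flen B"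
      and i: "eval_inv F tag arg (Suc (j + n)) (Suc n) (foldr (tok_step c F) (drop (Suc n) (toks B)) []) r' a'"
      by (cases s) (auto simp: I_def)
    let ?ts = "drop (Suc n) (toks B)"
    obtain t p where tp: "toks B ! n = (t, p)" by (cases "toks B ! n")
    have drop: "drop n (toks B) = (t, p) # ?ts"
      using n tp Cons_nth_drop_Suc[of n "toks B"] by (simp add: length_toks)
    \<comment> \<open>The tokens to the right of the current one notate a list of formulas. Their
      evaluation leaves one set per formula, which covers the operands of the current token.\<close>
    have "forest [B] = take n (toks B) @ (t, p) # ?ts"
      using drop by (metis append_take_drop_id forest_simps append_Nil2)
    then obtain As where "forest As = (t, p) # ?ts" using forest_suffix by metis
    then have ar: "(t = 1 \<longrightarrow> (\<exists>S1 S2 L'. foldr (tok_step c F) ?ts [] = S1 # S2 # L')) \<and>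
      (t = 2 \<longrightarrow> (\<exists>S L'. foldr (tok_step c F) ?ts [] = S # L') \<and> (\<exists>b. p = enc_mod b))"
      by (rule forest_Cons) (auto simp: foldr_toks)
    have "wp w (eval_body c) s (60 * (cnt F + length (occ F)) + 20)
      (\<lambda>(r', a'). eval_inv F tag arg (j + n) n (tok_step c F (t, p) (foldr (tok_step c F) ?ts [])) r' a')"
      unfolding s by (rule eval_body_correct[OF i wf]) (use tag[OF n] tp ar in auto)
    then have "wp w (eval_body c) s (60 * (cnt F + length (occ F)) + 20) (I n)"
      by (rule wp_mono) (use n drop in \<open>auto simp: I_def simp del: tok_step.simps\<close>)
    then show "fst s 4 \<noteq> 0 \<and> wp w (eval_body c) s (60 * (cnt F + length (occ F)) + 20) (I n)"
      using s i by (simp add: eval_inv_def)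
  next
    show "I (flen B) (r, a)" using inv by (simp add: I_def length_toks[symmetric])
  qed (auto simp: I_def eval_inv_def)
  then show ?thesis
    by (rule wp_mono) (auto simp: I_def foldr_toks)
qed

section \<open>Reading the input\<close>

text \<open>The difference is 0 exactly from position 31 on, where symbols still sit in their
  original cells.\<close>

definition in_code :: "nat \<Rightarrow> com" where
  "in_code x = Op (AConst 22 31) ;; Op (ASub 22 22 21) ;;
     Cond 22 (Op (AIn False x 21)) (Op (AIn True x 21)) ;; Op (AAdd 21 21 0)"

lemma vc_in:
  assumes "r 0 = 1" "1 \<le> r 21" "r 21 \<le> length w" "x \<notin> {0, 21, 22}"
  shows "vc w (in_code x) Q (r, a) =
    Q (r(22 := 31 - r 21, x := w ! (r 21 - 1), 21 := r 21 + 1), a)"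
  using assms by (auto simp: in_code_def)

lemma cost_in: "cost (in_code x) = 6"
  by (simp add: in_code_def)

text \<open>Register 12 counts the formulas still to be read, initially \<open>A\<close> and
  \<open>B\<close>. \<open>Top\<close> and variables complete one, \<open>And\<close> demands one
  more, \<open>Dia\<close> leaves the number unchanged; 0 signals the end of the input.\<close>

definition tok_body :: com where
  "tok_body = in_code 6 ;; Op (APut 5 3 6) ;;
     Cond 6 (Op (ASub 12 12 0))
       (Op (ASub 6 6 0) ;; Cond 6 (Op (AAdd 12 12 0))
         (Op (ASub 6 6 0) ;; in_code 7 ;; Op (APut 6 3 7) ;; Cond 6 skip (Op (ASub 12 12 0)))) ;;
     Op (AAdd 3 3 0)"

definition tok_code :: com where
  "tok_code = (Op (AConst 0 1) ;; Op (AConst 9 0) ;; Op (AConst 21 1) ;; Op (AConst 3 0) ;; Op (AConst 12 2)) ;;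
     Loop 12 tok_body"

text \<open>Only tags from 2 on are followed by an argument in the input, so for the others the
  second array may hold anything.\<close>

definition toks_rep :: "mem \<Rightarrow> mem \<Rightarrow> (nat \<times> nat) list \<Rightarrow> bool" where
  "toks_rep tag arg ts \<longleftrightarrow>
    (\<forall>i<length ts. tag i = fst (ts ! i) \<and> (2 \<le> fst (ts ! i) \<longrightarrow> arg i = snd (ts ! i)))"

lemma toks_rep_snoc:
  "toks_rep tag arg ts \<Longrightarrow> \<forall>i<length ts. tag' i = tag i \<and> arg' i = arg i \<Longrightarrow> tag' (length ts) = t \<Longrightarrow>
    (2 \<le> t \<Longrightarrow> arg' (length ts) = p) \<Longrightarrow> toks_rep tag' arg' (ts @ [(t, p)])"
  by (auto simp: toks_rep_def nth_append less_Suc_eq)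

lemma tok_correct:
  assumes w: "w = concat (map enc [A, B])"
  shows "wp w tok_code s (30 * (flen A + flen B) + 6)
    (\<lambda>(r, a). r 0 = 1 \<and> r 9 = 0 \<and> r 3 = flen A + flen B \<and> toks_rep (a 5) (a 6) (toks A @ toks B))"
proof -
  \<comment> \<open>\<open>As\<close> lists the formulas still expected, \<open>us\<close> the
    symbols consumed and \<open>ts\<close> the tokens found so far.\<close>
  define J where "J = (\<lambda>n (r :: mem) (a :: nat \<Rightarrow> mem). \<exists>As ts us. n = length (forest As)
    \<and> w = us @ concat (map enc As) \<and> r 21 = length us + 1 \<and> forest [A, B] = ts @ forest As \<and> r 3 = length ts
    \<and> r 12 = length As \<and> r 0 = 1 \<and> r 9 = 0 \<and> toks_rep (a 5) (a 6) ts)"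
  have step: "r 12 \<noteq> 0 \<and> vc w tok_body (\<lambda>(r', a'). J n r' a') (r, a)" if J: "J (Suc n) r a" for n r a
  proof -
    obtain As ts us where j: "Suc n = length (forest As)" "w = us @ concat (map enc As)" "r 21 = length us + 1"
      "forest [A, B] = ts @ forest As" "r 3 = length ts" "r 12 = length As" "r 0 = 1" "r 9 = 0"
      "toks_rep (a 5) (a 6) ts"
      using J unfolding J_def by blast
    obtain C Cs where As: "As = C # Cs" using j(1) by (cases As) auto
    note st = j(3,5,7,8) j(6)[unfolded As list.size]
    have JI: "J n r' a'"
      if "w = us' @ concat (map enc As')" "r' 21 = length us' + 1" "forest As = (t, p) # forest As'"
        "r' 3 = Suc (length ts)" "r' 12 = length As'" "r' 0 = 1" "r' 9 = 0"
        "\<forall>i<length ts. a' 5 i = a 5 i \<and> a' 6 i = a 6 i" "a' 5 (length ts) = t"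
        "2 \<le> t \<Longrightarrow> a' 6 (length ts) = p" for us' As' t p r' a'
      unfolding J_def
      by (rule exI[of _ As'], rule exI[of _ "ts @ [(t, p)]"], rule exI[of _ us'])
        (use that j toks_rep_snoc[OF j(9), of "a' 5" "a' 6" t p] in auto)
    have "vc w tok_body (\<lambda>(r', a'). J n r' a') (r, a)"
    proof (cases C)
      case (Var p)
      then have wl: "w = us @ [3, p] @ concat (map enc Cs)" "w ! length us = 3" "w ! Suc (length us) = p"
        "Suc (Suc (length us)) \<le> length w" "Suc (length us) \<le> length w" using j As by (simp_all add: nth_append)
      show ?thesis
        by (simp add: tok_body_def vc_in st wl(2-5), rule JI[of "us @ [3, p]" Cs _ 3 p]) (use wl(1) As Var in \<open>simp_all add: st\<close>)
    next
      case Top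
      then have wl: "w = us @ [0] @ concat (map enc Cs)" "w ! length us = 0"
        "Suc (length us) \<le> length w" using j As by (simp_all add: nth_append)
      show ?thesis
        by (simp add: tok_body_def vc_in st wl(2-3), rule JI[of "us @ [0]" Cs _ 0 0]) (use wl(1) As Top in \<open>simp_all add: st\<close>)
    next
      case (And C1 C2)
      then have wl: "w = us @ [1] @ concat (map enc (C1 # C2 # Cs))" "w ! length us = 1"
        "Suc (length us) \<le> length w" using j As by (simp_all add: nth_append)
      show ?thesis
        by (simp add: tok_body_def vc_in st wl(2-3), rule JI[of "us @ [1]" "C1 # C2 # Cs" _ 1 0]) (use wl(1) As And in \<open>simp_all add: st\<close>)
    next
      case (Dia b C1)
      then have wl: "w = us @ [2, enc_mod b] @ concat (map enc (C1 # Cs))" "w ! length us = 2"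
        "w ! Suc (length us) = enc_mod b" "Suc (Suc (length us)) \<le> length w" "Suc (length us) \<le> length w"
        using j As by (simp_all add: nth_append)
      show ?thesis
        by (simp add: tok_body_def vc_in st wl(2-5), rule JI[of "us @ [2, enc_mod b]" "C1 # Cs" _ 2 "enc_mod b"]) (use wl(1) As Dia in \<open>simp_all add: st\<close>)
    qed
    then show ?thesis using j As by simp
  qed
  have zero: "r 12 = 0" if J: "J 0 r a" for r a
  proof -
    obtain As where "length (forest As) = 0" "r 12 = length As" using J unfolding J_def by metis
    then show ?thesis using length_toks flen_pos by (cases As) (auto, metis less_numeral_extra(3) list.size(3))
  qed
  show ?thesis
    unfolding tok_code_def
  proof (rule wp_seqI[OF wp_vc])
    show "vc w (Op (AConst 0 1) ;; Op (AConst 9 0) ;; Op (AConst 21 1) ;; Op (AConst 3 0) ;; Op (AConst 12 2))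
      (\<lambda>(r, a). J (flen A + flen B) r a) s"
      by (cases s) (auto simp: J_def toks_rep_def length_toks w intro!: exI[of _ "[A, B]"])
  next
    fix r a assume "(\<lambda>(r, a). J (flen A + flen B) r a) (r, a)"
    then have J: "J (flen A + flen B) r a" by simp
    have "wp w (Loop 12 tok_body) (r, a) (30 * (flen A + flen B) + 1) (\<lambda>(r', a'). J 0 r' a')"
      by (rule wp_loopI[where I = J and n = "flen A + flen B"])
        (erule step zero | rule J | simp add: tok_body_def cost_in)+
    then show "wp w (Loop 12 tok_body) (r, a) (30 * (flen A + flen B) + 1)
      (\<lambda>(r, a). r 0 = 1 \<and> r 9 = 0 \<and> r 3 = flen A + flen B \<and> toks_rep (a 5) (a 6) (toks A @ toks B))"
    proof (rule wp_mono; clarify)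
      fix r a assume "J 0 r a"
      then obtain ts where "r 0 = 1" "r 9 = 0" "forest [A, B] = ts" "r 3 = length ts" "toks_rep (a 5) (a 6) ts"
        unfolding J_def by (metis append_Nil2 length_0_conv)
      then show "r 0 = 1 \<and> r 9 = 0 \<and> r 3 = flen A + flen B \<and> toks_rep (a 5) (a 6) (toks A @ toks B)"
        by (auto simp: length_toks)
    qed
  qed auto
qed

text \<open>Array 4 keeps, for each formula still to be parsed, the node at which it has to hold.
  \<open>And\<close> duplicates the top, \<open>Dia\<close> replaces it by a new node, leaves remove
  it. The stack runs empty exactly at the end of \<open>A\<close>.\<close>

definition parse_body :: com where
  "parse_body = Op (ASub 10 5 0) ;; Op (AGet 20 4 10) ;; Op (AGet 6 5 21) ;; Op (AGet 7 6 21) ;;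
     Op (AAdd 21 21 0) ;;
     Cond 6 (Op (ASub 5 5 0))
       (Op (ASub 6 6 0) ;; Cond 6 (Op (APut 4 5 20) ;; Op (AAdd 5 5 0))
         (Op (ASub 6 6 0) ;; Cond 6 (Op (APut 0 1 20) ;; Op (APut 1 1 7) ;; Op (APut 4 10 1) ;; Op (AAdd 1 1 0))
           (Op (APut 2 2 20) ;; Op (APut 3 2 7) ;; Op (AAdd 2 2 0) ;; Op (ASub 5 5 0))))"

text \<open>The last store puts 1, the content of register 0, into the label of the root: the code
  of modality 0.\<close>

definition parse_code :: com where
  "parse_code = (Op (AConst 21 0) ;; Op (AConst 1 1) ;; Op (AConst 2 0) ;; Op (AConst 5 1) ;; Op (AConst 10 0) ;;
     Op (APut 4 10 10) ;; Op (APut 1 10 0)) ;; Loop 5 parse_body"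

fun stack_rep :: "mem \<Rightarrow> nat list \<Rightarrow> bool" where
  "stack_rep b [] = True"
| "stack_rep b (x # xs) = (b (length xs) = x \<and> stack_rep b xs)"

lemma stack_rep_upd: "length xs \<le> i \<Longrightarrow> stack_rep (b(i := x)) xs = stack_rep b xs"
  by (induction xs) auto

lemma parse_correct:
  assumes r: "r 0 = 1" "r 9 = 0" "r 3 = q" and tr: "toks_rep (a 5) (a 6) (toks A @ ts)"
  shows "wp w parse_code (r, a) (30 * flen A + 8)
    (\<lambda>(r', a'). r' 0 = 1 \<and> r' 9 = 0 \<and> r' 3 = q \<and> r' 21 = flen A \<and> frame_rep (build A 0 root_frame) r' a'
      \<and> a' 5 = a 5 \<and> a' 6 = a 6)"
proof -
  let ?G = "build A 0 root_frame"
  \<comment> \<open>\<open>L\<close> pairs the pending formulas with their nodes; the last conjunct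
    says that building them onto the current \<open>F\<close> still leads to the intended
    tree.\<close>
  define J where "J = (\<lambda>n (r' :: mem) (a' :: nat \<Rightarrow> mem). \<exists>L us F. n = length (forest (map fst L))
    \<and> r' 0 = 1 \<and> r' 9 = 0 \<and> r' 3 = q \<and> a' 5 = a 5 \<and> a' 6 = a 6
    \<and> r' 21 = length us \<and> toks A = us @ forest (map fst L)
    \<and> r' 5 = length L \<and> stack_rep (a' 4) (map snd L) \<and> frame_rep F r' a'
    \<and> fold (\<lambda>(C, x) F. build C x F) L F = ?G)"
  have step: "r' 5 \<noteq> 0 \<and> vc w parse_body (\<lambda>(r', a'). J n r' a') (r', a')" if J: "J (Suc n) r' a'" for n r' a'
  proof -
    obtain L us F where j: "Suc n = length (forest (map fst L))" "r' 0 = 1" "r' 9 = 0" "r' 3 = q"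
      "a' 5 = a 5" "a' 6 = a 6" "r' 21 = length us" "toks A = us @ forest (map fst L)"
      "r' 5 = length L" "stack_rep (a' 4) (map snd L)" "frame_rep F r' a'"
      "fold (\<lambda>(C, x) F. build C x F) L F = ?G"
      using J unfolding J_def by blast
    obtain C x L' where L: "L = (C, x) # L'" using j(1) by (cases L) auto
    have x: "a' 4 (length L') = x" "stack_rep (a' 4) (map snd L')" using j(10) L by auto
    obtain t p where tp: "hd (forest (map fst L)) = (t, p)" by (cases "hd (forest (map fst L))")
    then have hd: "forest (map fst L) = (t, p) # tl (forest (map fst L))"
      using j(1) by (cases "forest (map fst L)") auto
    have tok: "a 5 (length us) = t" "2 \<le> t \<Longrightarrow> a 6 (length us) = p"
    proof -
      have "toks A @ ts = us @ (t, p) # (tl (forest (map fst L)) @ ts)" using j(8) hd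
        by (metis append.assoc append_Cons)
      then have "length us < length (toks A @ ts)" "(toks A @ ts) ! length us = (t, p)" by simp_all
      then show "a 5 (length us) = t" "2 \<le> t \<Longrightarrow> a 6 (length us) = p"
        using tr unfolding toks_rep_def by (metis fst_conv snd_conv)+
    qed
    have JI: "J n r2 a2"
      if "tl (forest (map fst L)) = forest (map fst L2)" "r2 0 = 1" "r2 9 = 0" "r2 3 = q" "a2 5 = a 5" "a2 6 = a 6"
        "r2 21 = Suc (length us)" "r2 5 = length L2" "stack_rep (a2 4) (map snd L2)" "frame_rep F2 r2 a2"
        "fold (\<lambda>(C, x) F. build C x F) L2 F2 = ?G" for L2 F2 r2 a2
    proof -
      have "n = length (forest (map fst L2))" using j(1) that(1) by (metis length_tl diff_Suc_1)
      moreover have "toks A = (us @ [(t, p)]) @ forest (map fst L2)"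
        using j(8) hd that(1) by (metis append.assoc append_Cons append_Nil)
      ultimately show ?thesis
        unfolding J_def using that(2-)
        by (intro exI[of _ L2] exI[of _ "us @ [(t, p)]"] exI[of _ F2]) simp
    qed
    note st = j(2-7) j(9)[unfolded L list.size] x(1)
    have "vc w parse_body (\<lambda>(r', a'). J n r' a') (r', a')"
    proof (cases C)
      case (Var v)
      then have tp: "t = 3" "p = v" using hd L by auto
      show ?thesis
        by (simp add: parse_body_def st tp tok[unfolded tp, simplified], rule JI[of L' _ _ "F\<lparr>occ := occ F @ [(x, v)]\<rparr>"])
          (use j(11,12) Var L x in \<open>auto simp: st frame_rep_def nth_append less_Suc_eq stack_rep_upd stack_rep_upd[unfolded fun_upd_def]\<close>)
    next
      case Top
      then have tp: "t = 0" using hd L by auto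
      show ?thesis
        by (simp add: parse_body_def st tp tok[unfolded tp, simplified], rule JI[of L' _ _ F])
          (use j(11,12) Top L x in \<open>auto simp: st frame_rep_def nth_append less_Suc_eq stack_rep_upd stack_rep_upd[unfolded fun_upd_def]\<close>)
    next
      case (And C1 C2)
      then have tp: "t = 1" using hd L by auto
      show ?thesis
        by (simp add: parse_body_def st tp tok[unfolded tp, simplified], rule JI[of "(C1, x) # (C2, x) # L'" _ _ F])
          (use j(11,12) And L x in \<open>auto simp: st frame_rep_def nth_append less_Suc_eq stack_rep_upd stack_rep_upd[unfolded fun_upd_def]\<close>)
    next
      case (Dia b C1)
      then have tp: "t = 2" "p = enc_mod b" using hd L by auto
      show ?thesis
        by (simp add: parse_body_def st tp tok[unfolded tp, simplified], rule JI[of "(C1, cnt F) # L'" _ _ "F\<lparr>cnt := Suc (cnt F), par := (par F)(cnt F := x), lab := (lab F)(cnt F := b)\<rparr>"])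
          (use j(11,12) Dia L x in \<open>auto simp: st frame_rep_def nth_append less_Suc_eq stack_rep_upd stack_rep_upd[unfolded fun_upd_def]\<close>)
    qed
    then show ?thesis using j L by simp
  qed
  have zero: "r' 5 = 0" if J: "J 0 r' a'" for r' a'
  proof -
    obtain L :: "(fm \<times> nat) list" where "0 = length (forest (map fst L))" "r' 5 = length L" using J unfolding J_def by blast
    then show ?thesis using length_toks flen_pos by (cases L) (auto, metis less_numeral_extra(3) list.size(3))
  qed
  show ?thesis
    unfolding parse_code_def
  proof (rule wp_seqI[OF wp_vc])
    show "vc w (Op (AConst 21 0) ;; Op (AConst 1 1) ;; Op (AConst 2 0) ;; Op (AConst 5 1) ;; Op (AConst 10 0) ;;
      Op (APut 4 10 10) ;; Op (APut 1 10 0)) (\<lambda>(r', a'). J (flen A) r' a') (r, a)"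
      using r by (auto simp: J_def length_toks frame_rep_def root_frame_def zero_enat_def
        intro!: exI[of _ "[(A, 0)]"] exI[of _ root_frame])
  next
    fix r1 a1 assume "(\<lambda>(r', a'). J (flen A) r' a') (r1, a1)"
    then have J: "J (flen A) r1 a1" by simp
    have "wp w (Loop 5 parse_body) (r1, a1) (30 * flen A + 1) (\<lambda>(r', a'). J 0 r' a')"
      by (rule wp_loopI[where I = J and n = "flen A"])
        (erule step zero | rule J | simp add: parse_body_def)+
    then show "wp w (Loop 5 parse_body) (r1, a1) (30 * flen A + 1)
      (\<lambda>(r', a'). r' 0 = 1 \<and> r' 9 = 0 \<and> r' 3 = q \<and> r' 21 = flen A \<and> frame_rep ?G r' a' \<and> a' 5 = a 5 \<and> a' 6 = a 6)"
    proof (rule wp_mono; clarify)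
      fix r' a' assume J0: "J 0 r' a'"
      then have "r' 5 = 0" by (rule zero)
      then show "r' 0 = 1 \<and> r' 9 = 0 \<and> r' 3 = q \<and> r' 21 = flen A \<and> frame_rep ?G r' a' \<and> a' 5 = a 5 \<and> a' 6 = a 6"
        using J0 unfolding J_def by (auto simp: length_toks[symmetric])
    qed
  qed auto
qed

section \<open>The decision procedure and its running time\<close>

lemma build_size: "cnt (build A x F) + length (occ (build A x F)) \<le> cnt F + length (occ F) + flen A"
proof (induction A arbitrary: x F)
  case (And A B)
  show ?case using And.IH(1)[of x F] And.IH(2)[of x "build A x F"] by simp
next
  case (Dia a A)
  show ?case
    using Dia.IH[of "cnt F" "F\<lparr>cnt := Suc (cnt F), par := (par F)(cnt F := x), lab := (lab F)(cnt F := a)\<rparr>"] by simp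
qed auto

text \<open>After parsing, register 21 holds |A|, so the subtraction leaves the number of tokens of
  \<open>B\<close>. The answer is the entry of the root in the only row left on the stack.\<close>

definition decide_code :: "bool \<Rightarrow> com" where
  "decide_code c = tok_code ;; parse_code ;; (Op (ASub 4 3 21) ;; Op (AConst 5 0)) ;; Loop 4 (eval_body c) ;;
     (Op (AConst 10 0) ;; Op (AGet 8 7 10))"

lemma com_wf_decide: "com_wf (decide_code c)"
  by (simp add: decide_code_def tok_code_def tok_body_def in_code_def parse_code_def parse_body_def
    eval_body_def fill_code_def fill_body_def and_code_def and_body_def dia_code_def up_body_def
    cmp_code_def spread_body_def var_code_def var_body_def)

lemma decide_correct:
  "wp (enc_sequent A B) (decide_code c) s (30 * (2 * flen A + flen B) + flen B * (60 * (1 + flen A) + 21) + 19)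
    (\<lambda>s'. (fst s' 8 \<noteq> 0) = deriv c A B)"
proof -
  let ?w = "enc_sequent A B" and ?G = "build A 0 root_frame"
  have wf: "wf_frame ?G" by (rule wf_build[OF wf_root_frame]) (simp add: root_frame_def)
  \<comment> \<open>Each symbol of \<open>A\<close> adds at most one node or one occurrence, and the
    root comes on top. This keeps the work per token of \<open>B\<close> linear in |A|.\<close>
  have size: "cnt ?G + length (occ ?G) \<le> 1 + flen A"
    using build_size[of A 0 root_frame] by (simp add: root_frame_def)
  show ?thesis
    unfolding decide_code_def
  proof (rule wp_seqI[OF tok_correct[of _ A B]])
    fix r1 :: mem and a1 :: "nat \<Rightarrow> mem"
    assume 1: "(\<lambda>(r, a). r 0 = 1 \<and> r 9 = 0 \<and> r 3 = flen A + flen B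
      \<and> toks_rep (a 5) (a 6) (toks A @ toks B)) (r1, a1)"
    then have tr: "toks_rep (a1 5) (a1 6) (toks A @ toks B)" by simp
    show "wp ?w (parse_code ;; (Op (ASub 4 3 21) ;; Op (AConst 5 0)) ;; Loop 4 (eval_body c) ;;
        (Op (AConst 10 0) ;; Op (AGet 8 7 10))) (r1, a1)
      (30 * flen A + flen B * (60 * (1 + flen A) + 21) + 13) (\<lambda>s'. (fst s' 8 \<noteq> 0) = deriv c A B)"
    proof (rule wp_seqI[OF parse_correct[of r1 "flen A + flen B" a1 A "toks B"]])
      fix r2 :: mem and a2 :: "nat \<Rightarrow> mem"
    assume 2: "(\<lambda>(r', a'). r' 0 = 1 \<and> r' 9 = 0 \<and> r' 3 = flen A + flen B \<and> r' 21 = flen A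
        \<and> frame_rep ?G r' a' \<and> a' 5 = a1 5 \<and> a' 6 = a1 6) (r2, a2)"
      show "wp ?w ((Op (ASub 4 3 21) ;; Op (AConst 5 0)) ;; Loop 4 (eval_body c) ;;
          (Op (AConst 10 0) ;; Op (AGet 8 7 10))) (r2, a2)
        (flen B * (60 * (1 + flen A) + 21) + 5) (\<lambda>s'. (fst s' 8 \<noteq> 0) = deriv c A B)"
      proof (rule wp_seqI[OF wp_vc])
        show "vc ?w (Op (ASub 4 3 21) ;; Op (AConst 5 0))
          (\<lambda>(r, a). eval_inv ?G (a1 5) (a1 6) (flen A + flen B) (flen B) [] r a) (r2, a2)"
          using 2 by (simp add: eval_inv_def frame_rep_def)
      next
        fix r3 :: mem and a3 :: "nat \<Rightarrow> mem"
        assume "(\<lambda>(r, a). eval_inv ?G (a1 5) (a1 6) (flen A + flen B) (flen B) [] r a) (r3, a3)"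
        then have 3: "eval_inv ?G (a1 5) (a1 6) (flen A + flen B) (flen B) [] r3 a3" by simp
        have tag: "a1 5 (flen A + i) = fst (toks B ! i) \<and> (2 \<le> fst (toks B ! i) \<longrightarrow> a1 6 (flen A + i) = snd (toks B ! i))"
          if "i < flen B" for i
          using tr that unfolding toks_rep_def
          by (auto simp: nth_append length_toks dest!: spec[of _ "flen A + i"])
        show "wp ?w (Loop 4 (eval_body c) ;; (Op (AConst 10 0) ;; Op (AGet 8 7 10))) (r3, a3)
          (flen B * (60 * (1 + flen A) + 21) + 3) (\<lambda>s'. (fst s' 8 \<noteq> 0) = deriv c A B)"
        proof (rule wp_seqI[OF eval_correct[OF 3 wf tag]])
          fix r4 :: mem and a4 :: "nat \<Rightarrow> mem"
    assume 4: "(\<lambda>(r', a'). eval_inv ?G (a1 5) (a1 6) (flen A) 0 [{x. sat c ?G x B}] r' a') (r4, a4)"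
          have "0 < cnt ?G" using wf by (simp add: wf_frame_def)
          then have "(a4 7 0 \<noteq> 0) = deriv c A B" using 4 by (simp add: eval_inv_def deriv_iff_sat)
          then show "wp ?w (Op (AConst 10 0) ;; Op (AGet 8 7 10)) (r4, a4) 2 (\<lambda>s'. (fst s' 8 \<noteq> 0) = deriv c A B)"
            by (intro wp_vc) auto
        next
          have "flen B * (60 * (cnt ?G + length (occ ?G)) + 21) \<le> flen B * (60 * (1 + flen A) + 21)"
            using size by (intro mult_le_mono2) simp
          then show "flen B * (60 * (cnt ?G + length (occ ?G)) + 21) + 1 + 2 \<le> flen B * (60 * (1 + flen A) + 21) + 3"
            by simp
        qed
      qed auto
    qed (use 1 tr in auto)
  qed (auto simp: enc_sequent_def)
qed

lemma decides:
  "ram_decides_within (assemble 8 (decide_code c)) (enc_sequent A B) (deriv c A B) (1900 * flen A ^ 2 * flen B)"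
proof -
  let ?T = "30 * (2 * flen A + flen B) + flen B * (60 * (1 + flen A) + 21) + 19"
  have "1 \<le> length (enc_sequent A B)" by (cases A) (auto simp: enc_sequent_def)
  then have "ram_decides_within (assemble 8 (decide_code c)) (enc_sequent A B) (deriv c A B) (7 * ?T + 68)"
    by (rule assemble_decides[OF _ com_wf_decide _ decide_correct]) simp
  \<comment> \<open>With a = |A| and b = |B| the left side is 420ab + 420a + 777b + 201. Each
    monomial is at most the square of a times b because a and b are positive, and the coefficients
    add up to 1818.\<close>
  moreover have "7 * ?T + 68 \<le> 1900 * flen A ^ 2 * flen B"
  proof -
    obtain x y where xy: "flen A = Suc x" "flen B = Suc y"
      using flen_pos[of A] flen_pos[of B] by (metis gr0_conv_Suc)
    show ?thesis unfolding xy by (simp add: power2_eq_square algebra_simps)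
  qed
  ultimately show ?thesis by (rule ram_decides_within_mono)
qed

theorem theorem5p4:
  shows "(\<exists>P c. \<forall>A B. ram_decides_within P (enc_sequent A B) (RC A B)
              (c * flen A ^ 2 * max 1 (card (mods A \<union> mods B)) * flen B))
       \<and> (\<exists>P c. \<forall>A B. ram_decides_within P (enc_sequent A B) (RJ A B)
              (c * flen A ^ 2 * flen B))"
proof (intro conjI exI allI)
  fix A B
  show "ram_decides_within (assemble 8 (decide_code False)) (enc_sequent A B) (RJ A B) (1900 * flen A ^ 2 * flen B)"
    by (rule decides)
  have "1900 * flen A ^ 2 * 1 * flen B \<le> 1900 * flen A ^ 2 * max 1 (card (mods A \<union> mods B)) * flen B"
    by (intro mult_le_mono1 mult_le_mono2) simp
  then have "1900 * flen A ^ 2 * flen B \<le> 1900 * flen A ^ 2 * max 1 (card (mods A \<union> mods B)) * flen B"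
    by simp
  then show "ram_decides_within (assemble 8 (decide_code True)) (enc_sequent A B) (RC A B)
      (1900 * flen A ^ 2 * max 1 (card (mods A \<union> mods B)) * flen B)"
    by (rule ram_decides_within_mono[OF decides])
qed

end
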